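(* Let $F:M^{n}\to\mathbb{H}^{n+1}\subset\mathbb{L}^{n+2}$ be a connected isometric immersion of a totally umbilic hypersurface in the hyperbolic space, with inward unit normal vector field $N$ and all the principal curvatures equal to $k$, where $k\notin\{-1,0,1\}$. Then the solution to the IMCF by parallel hypersurfaces with initial condition $F$ is given by $$F^{t}(x)=\cosh(\mu(t))F(x)+\sinh(\mu(t))N(x),$$ where $$\cosh(\mu(t))=\frac{e^{t/n}-|k|\sqrt{q(t)}}{1-k^{2}},\qquad \sinh(\mu(t))=\operatorname{sgn}(k)\,\frac{|k|e^{t/n}-\sqrt{q(t)}}{1-k^{2}},$$ for all $t\in I$ and $x\in M$, with $q(t)=e^{2t/n}+k^{2}-1$, $I$ being the maximal interval of definition of the solution. (i) If $0<|k|<1$, then $I=(t^{*},+\infty)$, where $t^{*}=\frac{n}{2}\ln(1-k^{2})$, i.e. $F^{t}$ is an immortal solution. Moreover, $F^{t}(M)$ converges to a totally geodesic hypersurface of $\mathbb{H}^{n+1}$ when $t\to t^{*}$ and it converges to $\partial\mathbb{H}^{n+1}$ when $t\to+\infty$. (ii) If $|k|>1$, then $I=\mathbb{R}$, i.e. $F^{t}$ is an eternal solution. Moreover, $F^{t}(M)$ converges to a point when $t\to-\infty$ and it converges to $\partial\mathbb{H}^{n+1}$ when $t\to+\infty$.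
   Context: $\mathbb{H}^{n+1}=\{x\in\mathbb{L}^{n+2}: -x_1^2+\sum_{i=2}^{n+2}x_i^2=-1,\ x_1>0\}$ in Lorentz space $\mathbb{L}^{n+2}$. For an oriented hypersurface $F:M^n\to\mathbb{H}^{n+1}$ (an immersion) with unit normal $N$, the second fundamental form is $II_x(v,w)=-\langle dN_x(v),dF_x(w)\rangle$, the principal curvatures $k_1,\dots,k_n$ are its eigenvalues with respect to the induced metric, and the mean curvature is $H=\sum_{i=1}^n k_i$ (not averaged). "Inward" normal means the choice of unit normal for which $H>0$. A one-parameter family of hypersurfaces $F^t:M\to\mathbb{H}^{n+1}$, $t\in I$, with $I\subset\mathbb{R}$ an open interval containing $0$, is a solution to the inverse mean curvature flow (IMCF) with initial condition $F$ if $\frac{\partial F^t}{\partial t}(x)=-\frac{1}{H^t(x)}N^t(x)$ for all $(x,t)\in M\times I$ and $F^0=F$, where $H^t$ is the mean curvature of $F^t$ with respect to its inward unit normal $N^t$ and $H^t(x)>0$ for all $(x,t)$. It is a solution by parallel hypersurfaces if there is a (smooth) function $\mu:I\to\mathbb{R}$ such that $F^t(x)=\cosh(\mu(t))F(x)+\sinh(\mu(t))N(x)$ for all $t\in I$, $x\in M$; the unit normal of $F^t$ is then $N^t(x)=\sinh(\mu(t))F(x)+\cosh(\mu(t))N(x)$. The solution is immortal if $I=(t^*,+\infty)$ with $t^*<0$ and eternal if $I=\mathbb{R}$. Let $G:\mathbb{H}^{n+1}\to\mathbb{B}^{n+1}$, $G(x_1,\dots,x_{n+2})=\frac{1}{x_1+1}(x_2,\dots,x_{n+1},-x_{n+2})$,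 be the isometry onto the Poincaré ball model (the open unit ball of $\mathbb{E}^{n+1}$ with metric $\frac{4}{(1-|x|^2)^2}\langle\cdot,\cdot\rangle$). The conformal boundary $\partial\mathbb{H}^{n+1}$ is the set of ideal points corresponding under $G$ to $\partial\mathbb{B}^{n+1}$. "$F^t(M)$ converges to $\partial\mathbb{H}^{n+1}$ when $t\to+\infty$" means that for every $x\in M$ the Euclidean norm satisfies $|G(F^t(x))|\to1$. Other convergence statements are pointwise in $x\in M$: $F^t(x)$ has a limit for every $x$, and the limit map is constant (convergence to a point), respectively an immersion with vanishing second fundamental form (convergence to a totally geodesic hypersurface; since $M$ need not be complete, the limit need not be complete). *)

theory Defs
  imports "HOL-Analysis.Analysis"
begin

section \<open>Smooth maps and smooth manifolds\<close>

primrec Ck_on :: "nat \<Rightarrow> 'a::real_normed_vector set \<Rightarrow> ('a \<Rightarrow> 'b::real_normed_vector) \<Rightarrow> bool" where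
  "Ck_on 0 S f \<longleftrightarrow> continuous_on S f"
| "Ck_on (Suc k) S f \<longleftrightarrow>
     (\<forall>x\<in>S. f differentiable (at x)) \<and> (\<forall>v. Ck_on k S (\<lambda>x. frechet_derivative f (at x) v))"

text \<open>Intended for open \<open>S\<close> only, since the derivatives are two-sided.\<close>

definition smooth_on :: "'a::real_normed_vector set \<Rightarrow> ('a \<Rightarrow> 'b::real_normed_vector) \<Rightarrow> bool" where
  "smooth_on S f \<longleftrightarrow> (\<forall>k. Ck_on k S f)"

text \<open>A chart \<open>(U, \<phi>)\<close> is a homeomorphism of the open set \<open>U\<close> onto an open subset of Euclidean
  space; the values of \<open>\<phi>\<close> outside \<open>U\<close> are irrelevant.  The manifold is the whole type \<open>'m\<close>,
  of dimension \<open>CARD('n)\<close>; an atlas need not be maximal.\<close>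

type_synonym ('m, 'n) chart = "'m set \<times> ('m \<Rightarrow> real ^ 'n)"

definition smooth_atlas :: "('m::topological_space, 'n::finite) chart set \<Rightarrow> bool" where
  "smooth_atlas A \<longleftrightarrow>
     (\<Union>c\<in>A. fst c) = UNIV \<and>
     (\<forall>(U, \<phi>)\<in>A. open U \<and> open (\<phi> ` U) \<and> homeomorphism U (\<phi> ` U) \<phi> (inv_into U \<phi>)) \<and>
     (\<forall>(U, \<phi>)\<in>A. \<forall>(V, \<psi>)\<in>A. smooth_on (\<phi> ` (U \<inter> V)) (\<psi> \<circ> inv_into U \<phi>))"

definition smooth_map ::
  "('m::topological_space, 'n::finite) chart set \<Rightarrow> ('m \<Rightarrow> 'b::real_normed_vector) \<Rightarrow> bool" where
  "smooth_map A f \<longleftrightarrow> (\<forall>(U, \<phi>)\<in>A. smooth_on (\<phi> ` U) (f \<circ> inv_into U \<phi>))"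

text \<open>The tangent space at \<open>x\<close> is identified with \<open>real ^ 'n\<close> through one chosen chart around \<open>x\<close>.
  The choice is immaterial: another chart changes all differentials at \<open>x\<close> by the same linear
  isomorphism of \<open>real ^ 'n\<close>, which affects neither injectivity of differentials nor the
  eigenvalues of one bilinear form with respect to another and their multiplicities.\<close>

definition chart_at :: "('m::topological_space, 'n::finite) chart set \<Rightarrow> 'm \<Rightarrow> ('m, 'n) chart" where
  "chart_at A x = (SOME c. c \<in> A \<and> x \<in> fst c)"

definition differential ::
  "('m::topological_space, 'n::finite) chart set \<Rightarrow> ('m \<Rightarrow> 'b::real_normed_vector)
    \<Rightarrow> 'm \<Rightarrow> real ^ 'n \<Rightarrow> 'b" where
  "differential A f x =
     (case chart_at A x of (U, \<phi>) \<Rightarrow> frechet_derivative (f \<circ> inv_into U \<phi>) (at (\<phi> x)))"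

section \<open>Hyperbolic space in Lorentz space\<close>

text \<open>A point \<open>(a, (y, b))\<close> stands for \<open>x\<close> with \<open>x\<^sub>1 = a\<close>, with \<open>y\<close> collecting the \<open>n\<close> middle
  coordinates, and with last coordinate \<open>b\<close>, where \<open>n = CARD('n)\<close>.\<close>

type_synonym 'n lorentz = "real \<times> ((real ^ 'n) \<times> real)"

definition lorentz_inner :: "'n::finite lorentz \<Rightarrow> 'n lorentz \<Rightarrow> real" where
  "lorentz_inner x y = - (fst x * fst y) + snd x \<bullet> snd y"

definition hyperbolic_space :: "'n::finite lorentz set" where
  "hyperbolic_space = {x. lorentz_inner x x = -1 \<and> fst x > 0}"

definition poincare_ball_map :: "'n::finite lorentz \<Rightarrow> (real ^ 'n) \<times> real" where
  "poincare_ball_map x = (1 / (fst x + 1)) *\<^sub>R (fst (snd x), - snd (snd x))"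

section \<open>Hypersurfaces\<close>

definition hypersurface ::
  "('m::topological_space, 'n::finite) chart set \<Rightarrow> ('m \<Rightarrow> 'n lorentz) \<Rightarrow> bool" where
  "hypersurface A F \<longleftrightarrow>
     smooth_map A F \<and> (\<forall>x. F x \<in> hyperbolic_space) \<and> (\<forall>x. inj (differential A F x))"

definition induced_metric ::
  "('m::topological_space, 'n::finite) chart set \<Rightarrow> ('m \<Rightarrow> 'n lorentz)
    \<Rightarrow> 'm \<Rightarrow> real ^ 'n \<Rightarrow> real ^ 'n \<Rightarrow> real" where
  "induced_metric A F x v w = lorentz_inner (differential A F x v) (differential A F x w)"

text \<open>Orthogonality to the position vector \<open>F x\<close> says that \<open>N x\<close> is tangent to hyperbolic space.\<close>

definition unit_normal ::
  "('m::topological_space, 'n::finite) chart set \<Rightarrow> ('m \<Rightarrow> 'n lorentz)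
    \<Rightarrow> ('m \<Rightarrow> 'n lorentz) \<Rightarrow> bool" where
  "unit_normal A F N \<longleftrightarrow>
     smooth_map A N \<and>
     (\<forall>x. lorentz_inner (N x) (N x) = 1 \<and> lorentz_inner (N x) (F x) = 0 \<and>
          (\<forall>v. lorentz_inner (N x) (differential A F x v) = 0))"

definition second_fundamental_form ::
  "('m::topological_space, 'n::finite) chart set \<Rightarrow> ('m \<Rightarrow> 'n lorentz)
    \<Rightarrow> ('m \<Rightarrow> 'n lorentz) \<Rightarrow> 'm \<Rightarrow> real ^ 'n \<Rightarrow> real ^ 'n \<Rightarrow> real" where
  "second_fundamental_form A F N x v w =
     - lorentz_inner (differential A N x v) (differential A F x w)"

definition curvature_eigenspace ::
  "('m::topological_space, 'n::finite) chart set \<Rightarrow> ('m \<Rightarrow> 'n lorentz)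
    \<Rightarrow> ('m \<Rightarrow> 'n lorentz) \<Rightarrow> 'm \<Rightarrow> real \<Rightarrow> (real ^ 'n) set" where
  "curvature_eigenspace A F N x \<kappa> =
     {v. \<forall>w. second_fundamental_form A F N x v w = \<kappa> * induced_metric A F x v w}"

definition principal_curvatures ::
  "('m::topological_space, 'n::finite) chart set \<Rightarrow> ('m \<Rightarrow> 'n lorentz)
    \<Rightarrow> ('m \<Rightarrow> 'n lorentz) \<Rightarrow> 'm \<Rightarrow> real set" where
  "principal_curvatures A F N x = {\<kappa>. \<exists>v. v \<noteq> 0 \<and> v \<in> curvature_eigenspace A F N x \<kappa>}"

text \<open>The sum (not the average) of the principal curvatures, counted with multiplicity.\<close>

definition mean_curvature ::
  "('m::topological_space, 'n::finite) chart set \<Rightarrow> ('m \<Rightarrow> 'n lorentz)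
    \<Rightarrow> ('m \<Rightarrow> 'n lorentz) \<Rightarrow> 'm \<Rightarrow> real" where
  "mean_curvature A F N x =
     (\<Sum>\<kappa>\<in>principal_curvatures A F N x. real (dim (curvature_eigenspace A F N x \<kappa>)) * \<kappa>)"

definition inward_unit_normal ::
  "('m::topological_space, 'n::finite) chart set \<Rightarrow> ('m \<Rightarrow> 'n lorentz)
    \<Rightarrow> ('m \<Rightarrow> 'n lorentz) \<Rightarrow> bool" where
  "inward_unit_normal A F N \<longleftrightarrow> unit_normal A F N \<and> (\<forall>x. mean_curvature A F N x > 0)"

definition totally_umbilic ::
  "('m::topological_space, 'n::finite) chart set \<Rightarrow> ('m \<Rightarrow> 'n lorentz)
    \<Rightarrow> ('m \<Rightarrow> 'n lorentz) \<Rightarrow> bool" where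
  "totally_umbilic A F N \<longleftrightarrow>
     (\<forall>x. \<exists>c. \<forall>v w. second_fundamental_form A F N x v w = c * induced_metric A F x v w)"

definition totally_geodesic ::
  "('m::topological_space, 'n::finite) chart set \<Rightarrow> ('m \<Rightarrow> 'n lorentz) \<Rightarrow> bool" where
  "totally_geodesic A F \<longleftrightarrow>
     hypersurface A F \<and>
     (\<exists>N. unit_normal A F N \<and> (\<forall>x v w. second_fundamental_form A F N x v w = 0))"

section \<open>Inverse mean curvature flow\<close>

definition imcf_solution ::
  "('m::topological_space, 'n::finite) chart set \<Rightarrow> ('m \<Rightarrow> 'n lorentz)
    \<Rightarrow> real set \<Rightarrow> (real \<Rightarrow> 'm \<Rightarrow> 'n lorentz) \<Rightarrow> bool" where
  "imcf_solution A F I \<Phi> \<longleftrightarrow>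
     open I \<and> is_interval I \<and> 0 \<in> I \<and> \<Phi> 0 = F \<and>
     (\<forall>t\<in>I. hypersurface A (\<Phi> t)) \<and>
     (\<exists>\<N>. \<forall>t\<in>I. inward_unit_normal A (\<Phi> t) (\<N> t) \<and>
       (\<forall>x. ((\<lambda>s. \<Phi> s x) has_vector_derivative
               - (1 / mean_curvature A (\<Phi> t) (\<N> t) x) *\<^sub>R \<N> t x) (at t)))"

definition parallel_imcf_solution ::
  "('m::topological_space, 'n::finite) chart set \<Rightarrow> ('m \<Rightarrow> 'n lorentz) \<Rightarrow> ('m \<Rightarrow> 'n lorentz)
    \<Rightarrow> real set \<Rightarrow> (real \<Rightarrow> real) \<Rightarrow> (real \<Rightarrow> 'm \<Rightarrow> 'n lorentz) \<Rightarrow> bool" where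
  "parallel_imcf_solution A F N I \<mu> \<Phi> \<longleftrightarrow>
     imcf_solution A F I \<Phi> \<and> smooth_on I \<mu> \<and>
     (\<forall>t\<in>I. \<forall>x. \<Phi> t x = cosh (\<mu> t) *\<^sub>R F x + sinh (\<mu> t) *\<^sub>R N x)"

text \<open>The solution on its maximal interval of definition: every solution by parallel hypersurfaces
  with the same initial condition is a restriction of it.  In particular it is unique.\<close>

definition maximal_parallel_imcf_solution ::
  "('m::topological_space, 'n::finite) chart set \<Rightarrow> ('m \<Rightarrow> 'n lorentz) \<Rightarrow> ('m \<Rightarrow> 'n lorentz)
    \<Rightarrow> real set \<Rightarrow> (real \<Rightarrow> real) \<Rightarrow> (real \<Rightarrow> 'm \<Rightarrow> 'n lorentz) \<Rightarrow> bool" where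
  "maximal_parallel_imcf_solution A F N I \<mu> \<Phi> \<longleftrightarrow>
     parallel_imcf_solution A F N I \<mu> \<Phi> \<and>
     (\<forall>J \<nu> \<Psi>. parallel_imcf_solution A F N J \<nu> \<Psi> \<longrightarrow>
        J \<subseteq> I \<and> (\<forall>t\<in>J. \<nu> t = \<mu> t \<and> \<Psi> t = \<Phi> t))"

definition immortal :: "real set \<Rightarrow> bool" where
  "immortal I \<longleftrightarrow> (\<exists>t<0. I = {t<..})"

definition eternal :: "real set \<Rightarrow> bool" where
  "eternal I \<longleftrightarrow> I = UNIV"

definition converges_to_point ::
  "(real \<Rightarrow> 'm \<Rightarrow> 'n::finite lorentz) \<Rightarrow> real filter \<Rightarrow> bool" where
  "converges_to_point \<Phi> T \<longleftrightarrow> (\<exists>p\<in>hyperbolic_space. \<forall>x. ((\<lambda>t. \<Phi> t x) \<longlongrightarrow> p) T)"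

definition converges_to_totally_geodesic ::
  "('m::topological_space, 'n::finite) chart set \<Rightarrow> (real \<Rightarrow> 'm \<Rightarrow> 'n lorentz)
    \<Rightarrow> real filter \<Rightarrow> bool" where
  "converges_to_totally_geodesic A \<Phi> T \<longleftrightarrow>
     (\<exists>L. totally_geodesic A L \<and> (\<forall>x. ((\<lambda>t. \<Phi> t x) \<longlongrightarrow> L x) T))"

definition converges_to_ideal_boundary ::
  "(real \<Rightarrow> 'm \<Rightarrow> 'n::finite lorentz) \<Rightarrow> real filter \<Rightarrow> bool" where
  "converges_to_ideal_boundary \<Phi> T \<longleftrightarrow>
     (\<forall>x. ((\<lambda>t. norm (poincare_ball_map (\<Phi> t x))) \<longlongrightarrow> 1) T)"

end

theory Submission
  imports Defs
begin

text \<open>Since the hypersurface is umbilic with constant principal curvature \<open>k\<close>, the normal satisfies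
  \<open>dN = - k dF\<close> (\<open>umbilic_shape_operator\<close>), and positivity of the mean curvature \<open>n k\<close> forces
  \<open>k > 0\<close>.  Every map built from the frame \<open>(F, N)\<close> is then explicit:
  \<open>d (a F + b N) = (a - k b) dF\<close>.  With \<open>a = cosh \<mu>\<close> and \<open>b = sinh \<mu>\<close> this
  hypersurface has normal \<open>b F + a N\<close>, it is again umbilic, and its mean curvature is
  \<open>n d / c\<close>, where \<open>c = cosh \<mu> - k sinh \<mu>\<close> and \<open>d = k cosh \<mu> - sinh \<mu>\<close>
  (\<open>mean_curvature_combination\<close>).  The flow equation therefore collapses to the scalar equation
  \<open>\<mu>' = - c / (n d)\<close>.

  Along a solution \<open>c' = c / n\<close>, because \<open>dc/d\<mu> = - d\<close>; hence \<open>c = exp (t / n)\<close>.  The identity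
  \<open>d\<^sup>2 - c\<^sup>2 = k\<^sup>2 - 1\<close> holds for every \<open>\<mu>\<close>, so \<open>d\<^sup>2 = q t\<close>, and \<open>d\<close> keeps the sign of
  its initial value \<open>k\<close>.  Thus \<open>c\<close> and \<open>d\<close>, and with them \<open>cosh \<mu>\<close> and \<open>sinh \<mu>\<close>,
  are forced, and \<open>q > 0\<close> wherever the solution lives (\<open>flow_distance_unique\<close>).  Conversely
  \<open>\<mu> = ln ((1 + k) / (exp (t / n) + sqrt (q t)))\<close> solves the equation wherever \<open>q > 0\<close>, so that
  set is the maximal interval.  An arbitrary solution comes with an unknown unit normal; it must be
  parallel to \<open>b F + a N\<close> because the velocity is, and its sign is the same at all points because
  the sign of \<open>\<mu>'\<close> determines it (\<open>parallel_imcf_solution_ode\<close>).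

  The limits are read off from the closed form.  When \<open>q\<close> vanishes, \<open>d = 0\<close>, so the shape operator
  of the limit vanishes.  For \<open>k > 1\<close> and \<open>t\<close> tending to minus infinity, \<open>c\<close> tends to \<open>0\<close>: this is
  the focal point, the limit map has zero differential and is constant since \<open>M\<close> is connected.  For
  \<open>t\<close> tending to infinity the time coordinate grows without bound because \<open>\<bar>fst (N x)\<bar> < fst (F x)\<close>,
  and in the ball model \<open>\<bar>G x\<bar>\<^sup>2 = (x\<^sub>1 - 1) / (x\<^sub>1 + 1)\<close>.\<close>

section \<open>Calculus of smooth maps\<close>

lemma Ck_on_cong:
  assumes "open S" and "\<And>x. x \<in> S \<Longrightarrow> f x = g x"
  shows "Ck_on k S f \<longleftrightarrow> Ck_on k S g"
  using assms(2)
proof (induction k arbitrary: f g)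
  case 0
  then show ?case by (simp cong: continuous_on_cong)
next
  case (Suc k)
  have der: "(f has_derivative D) (at x) \<longleftrightarrow> (g has_derivative D) (at x)" if "x \<in> S" for x D
  proof
    show "(f has_derivative D) (at x) \<Longrightarrow> (g has_derivative D) (at x)"
      using has_derivative_transform_within_open[of f D x UNIV S g] \<open>open S\<close> that Suc.prems
      by auto
    show "(g has_derivative D) (at x) \<Longrightarrow> (f has_derivative D) (at x)"
      using has_derivative_transform_within_open[of g D x UNIV S f] \<open>open S\<close> that Suc.prems
      by auto
  qed
  have "frechet_derivative f (at x) = frechet_derivative g (at x)" if "x \<in> S" for x
    unfolding frechet_derivative_def by (simp add: der[OF that])
  then have "Ck_on k S (\<lambda>x. frechet_derivative f (at x) v)
      \<longleftrightarrow> Ck_on k S (\<lambda>x. frechet_derivative g (at x) v)" for v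
    by (intro Suc.IH) auto
  then show ?case by (simp add: differentiable_def der)
qed

text \<open>The defining recursion speaks about the chosen value of the Frechet derivative operator;
  this rule replaces it by any known derivative.\<close>

lemma Ck_on_Suc_I:
  assumes "open S" and "\<And>x. x \<in> S \<Longrightarrow> (f has_derivative D x) (at x)"
    and "\<And>v. Ck_on k S (\<lambda>x. D x v)"
  shows "Ck_on (Suc k) S f"
proof -
  have "Ck_on k S (\<lambda>x. frechet_derivative f (at x) v)" for v
    using assms(3)[of v] Ck_on_cong[OF assms(1), of "\<lambda>x. frechet_derivative f (at x) v" "\<lambda>x. D x v" k]
      frechet_derivative_at[OF assms(2)] by fastforce
  then show ?thesis using assms(2) by (auto simp: differentiable_def)
qed

lemma Ck_on_Suc_imp_Ck_on:
  "Ck_on (Suc k) S f \<Longrightarrow> Ck_on k S f"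
proof (induction k arbitrary: f)
  case 0
  then show ?case
    by (auto intro!: continuous_at_imp_continuous_on differentiable_imp_continuous_within)
next
  case (Suc k)
  then show ?case by (metis Ck_on.simps(2))
qed

lemma Ck_on_const: "open S \<Longrightarrow> Ck_on k S (\<lambda>x. c)"
proof (induction k arbitrary: c)
  case (Suc k)
  then show ?case by (intro Ck_on_Suc_I[where D="\<lambda>_ _. 0"]) auto
qed auto

lemma Ck_on_add:
  assumes "open S" "Ck_on k S f" "Ck_on k S g"
  shows "Ck_on k S (\<lambda>x. f x + g x)"
  using assms(2,3)
proof (induction k arbitrary: f g)
  case 0
  then show ?case by (simp add: continuous_on_add)
next
  case (Suc k)
  show ?case
  proof (rule Ck_on_Suc_I[OF assms(1)])
    show "((\<lambda>x. f x + g x) has_derivative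
      (\<lambda>v. frechet_derivative f (at x) v + frechet_derivative g (at x) v)) (at x)" if "x \<in> S" for x
      using Suc.prems that by (auto intro!: has_derivative_add simp: frechet_derivative_works[symmetric])
  qed (use Suc in auto)
qed

text \<open>The product rule puts an undifferentiated factor next to a differentiated one, so the induction
  step also uses that both factors are of the lower class.\<close>

lemma Ck_on_scaleR:
  fixes f :: "'a::real_normed_vector \<Rightarrow> real"
  assumes "open S" "Ck_on k S f" "Ck_on k S g"
  shows "Ck_on k S (\<lambda>x. f x *\<^sub>R g x)"
  using assms(2,3)
proof (induction k arbitrary: f g)
  case 0
  then show ?case by (simp add: continuous_on_scaleR)
next
  case (Suc k)
  note lower = Suc.prems[THEN Ck_on_Suc_imp_Ck_on]
  show ?case
  proof (rule Ck_on_Suc_I[OF assms(1)])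
    show "((\<lambda>x. f x *\<^sub>R g x) has_derivative
      (\<lambda>v. f x *\<^sub>R frechet_derivative g (at x) v + frechet_derivative f (at x) v *\<^sub>R g x)) (at x)"
      if "x \<in> S" for x
      using Suc.prems that by (auto intro!: has_derivative_scaleR simp: frechet_derivative_works[symmetric])
  qed (use Suc lower in \<open>auto intro!: Ck_on_add[OF assms(1)]\<close>)
qed

lemma smooth_map_linear_combination:
  assumes "smooth_atlas A" "smooth_map A f" "smooth_map A g"
  shows "smooth_map A (\<lambda>x. a *\<^sub>R f x + b *\<^sub>R g x)"
  unfolding smooth_map_def
proof (safe)
  fix U \<phi> assume c: "(U, \<phi>) \<in> A"
  then have op: "open (\<phi> ` U)" using assms(1) by (auto simp: smooth_atlas_def)
  have "Ck_on k (\<phi> ` U) (f \<circ> inv_into U \<phi>)" "Ck_on k (\<phi> ` U) (g \<circ> inv_into U \<phi>)" for k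
    using c assms(2,3) by (auto simp: smooth_map_def smooth_on_def)
  then show "smooth_on (\<phi> ` U) ((\<lambda>x. a *\<^sub>R f x + b *\<^sub>R g x) \<circ> inv_into U \<phi>)"
    unfolding smooth_on_def o_def
    by (auto intro!: Ck_on_add[OF op] Ck_on_scaleR[OF op] Ck_on_const[OF op])
qed

section \<open>Lorentz space\<close>

text \<open>The Lorentz form is the Euclidean inner product after the reflection in the time coordinate.  Being
  bounded bilinear gives both the algebraic rules and the product rule for derivatives.\<close>

lemma bounded_bilinear_lorentz_inner: "bounded_bilinear (lorentz_inner :: 'n::finite lorentz \<Rightarrow> _)"
proof -
  have J: "bounded_linear (\<lambda>x::'n lorentz. (- fst x, snd x))"
    by (intro bounded_linear_Pair bounded_linear_minus bounded_linear_fst bounded_linear_snd)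
  have "lorentz_inner = (\<lambda>x y::'n lorentz. (- fst x, snd x) \<bullet> y)"
    by (auto simp: fun_eq_iff lorentz_inner_def inner_prod_def)
  then show ?thesis
    using bounded_bilinear.comp1[OF bounded_bilinear_inner J] by simp
qed

lemmas lorentz_simps =
  bounded_bilinear.add_left[OF bounded_bilinear_lorentz_inner]
  bounded_bilinear.add_right[OF bounded_bilinear_lorentz_inner]
  bounded_bilinear.scaleR_left[OF bounded_bilinear_lorentz_inner]
  bounded_bilinear.scaleR_right[OF bounded_bilinear_lorentz_inner]
  bounded_bilinear.minus_left[OF bounded_bilinear_lorentz_inner]
  bounded_bilinear.minus_right[OF bounded_bilinear_lorentz_inner]
  bounded_bilinear.zero_left[OF bounded_bilinear_lorentz_inner]
  bounded_bilinear.zero_right[OF bounded_bilinear_lorentz_inner]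

lemma lorentz_inner_self: "lorentz_inner x x = (norm (snd x))\<^sup>2 - (fst x)\<^sup>2"
  unfolding lorentz_inner_def power2_norm_eq_inner by (simp add: power2_eq_square)

lemma lorentz_inner_commute: "lorentz_inner x y = lorentz_inner y x"
  by (simp add: lorentz_inner_def inner_commute mult.commute)

text \<open>Tangent vectors of hyperbolic space are spacelike: orthogonality to the timelike \<open>p\<close> expresses the time
  component of \<open>X\<close> through an inner product of spatial parts, and Cauchy-Schwarz bounds it by
  the spatial norm.\<close>

lemma hyperbolic_tangent_pos:
  assumes "p \<in> hyperbolic_space" "lorentz_inner X p = 0" "X \<noteq> 0"
  shows "lorentz_inner X X > 0"
proof -
  have p: "(fst p)\<^sup>2 = 1 + (norm (snd p))\<^sup>2" "fst p > 0"
    using assms(1) by (auto simp: hyperbolic_space_def lorentz_inner_self)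
  have X: "fst X * fst p = snd X \<bullet> snd p" using assms(2) by (simp add: lorentz_inner_def)
  have "(fst X * fst p)\<^sup>2 \<le> (norm (snd X) * norm (snd p))\<^sup>2"
    unfolding X using Cauchy_Schwarz_ineq2 abs_le_square_iff
    by (metis abs_mult abs_norm_cancel)
  then have "(fst p)\<^sup>2 * ((norm (snd X))\<^sup>2 - (fst X)\<^sup>2) \<ge> (norm (snd X))\<^sup>2"
    by (simp add: p(1) power_mult_distrib algebra_simps)
  moreover have "snd X \<noteq> 0"
  proof
    assume "snd X = 0"
    then have "fst X = 0" using X p(2) by simp
    then show False using \<open>snd X = 0\<close> assms(3) by (simp add: prod_eq_iff)
  qed
  ultimately have "(fst p)\<^sup>2 * ((norm (snd X))\<^sup>2 - (fst X)\<^sup>2) > 0"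
    by (smt (verit) zero_less_norm_iff zero_less_power)
  then have "(norm (snd X))\<^sup>2 - (fst X)\<^sup>2 > 0"
    using p(2) by (simp add: zero_less_mult_iff)
  then show ?thesis by (simp add: lorentz_inner_self)
qed

text \<open>Cauchy-Schwarz for the spatial parts, rewritten with the two normalisations, says exactly
  \<open>(fst X)\<^sup>2 + 1 \<le> (fst p)\<^sup>2\<close>.  This strict bound is what makes \<open>cosh s p + sinh s X\<close> leave every
  compact set as \<open>s\<close> tends to plus or minus infinity.\<close>

lemma unit_tangent_time_coordinate:
  assumes "p \<in> hyperbolic_space" "lorentz_inner X X = 1" "lorentz_inner X p = 0"
  shows "\<bar>fst X\<bar> < fst p"
proof -
  have p: "(fst p)\<^sup>2 = 1 + (norm (snd p))\<^sup>2" "fst p > 0"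
    using assms(1) by (auto simp: hyperbolic_space_def lorentz_inner_self)
  have X: "fst X * fst p = snd X \<bullet> snd p" "(norm (snd X))\<^sup>2 = (fst X)\<^sup>2 + 1"
    using assms(2,3) by (simp_all add: lorentz_inner_self) (simp add: lorentz_inner_def)
  have "(fst X * fst p)\<^sup>2 \<le> (norm (snd X) * norm (snd p))\<^sup>2"
    unfolding X(1) using Cauchy_Schwarz_ineq2 abs_le_square_iff
    by (metis abs_mult abs_norm_cancel)
  then have "(fst X)\<^sup>2 < (fst p)\<^sup>2"
    unfolding power_mult_distrib X(2) p(1) by (simp add: algebra_simps)
  then show ?thesis using p(2) abs_le_square_iff[of "fst p" "fst X"] by (simp add: not_le[symmetric])
qed

lemma norm_poincare_ball_map:
  assumes "x \<in> hyperbolic_space"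
  shows "norm (poincare_ball_map x) = sqrt ((fst x - 1) / (fst x + 1))"
proof -
  have x: "(fst x)\<^sup>2 = 1 + (norm (snd x))\<^sup>2" "fst x > 0"
    using assms by (auto simp: hyperbolic_space_def lorentz_inner_self)
  have n: "norm (fst (snd x), - snd (snd x)) = norm (snd x)"
    by (simp add: norm_prod_def)
  have "(norm (poincare_ball_map x))\<^sup>2 = (norm (snd x))\<^sup>2 / (fst x + 1)\<^sup>2"
    unfolding poincare_ball_map_def norm_scaleR n using x(2) by (simp add: power_divide power_mult_distrib)
  also have "(norm (snd x))\<^sup>2 = (fst x - 1) * (fst x + 1)"
    using x(1) by (simp add: power2_eq_square algebra_simps)
  also have "(fst x - 1) * (fst x + 1) / (fst x + 1)\<^sup>2 = (fst x - 1) / (fst x + 1)"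
    using x(2) by (simp add: power2_eq_square)
  finally show ?thesis by (metis norm_ge_zero real_sqrt_unique)
qed

text \<open>The position vector, the unit normal and the tangent space of a hypersurface span Lorentz space.
  The vectors orthogonal to the first two form a space of dimension \<open>(n + 2) - 2\<close>, which is the rank
  of the injective differential \<open>L\<close>.\<close>

lemma hypersurface_tangent_space:
  fixes L :: "real ^ 'n::finite \<Rightarrow> 'n lorentz"
  assumes "p \<in> hyperbolic_space" "lorentz_inner u u = 1" "lorentz_inner u p = 0"
    and "linear L" "inj L" "\<And>v. lorentz_inner (L v) p = 0" "\<And>v. lorentz_inner (L v) u = 0"
    and "lorentz_inner y p = 0" "lorentz_inner y u = 0"
  shows "y \<in> range L"
proof -
  define J where "J = (\<lambda>x::'n lorentz. (- fst x, snd x))"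
  have inner_J: "J a \<bullet> b = lorentz_inner b a" for a b
    by (simp add: J_def lorentz_inner_def inner_prod_def inner_commute mult.commute)
  have pp: "lorentz_inner p p = -1" using assms(1) by (simp add: hyperbolic_space_def)
  define W where "W = {x. \<forall>w\<in>span {J p, J u}. orthogonal w x}"
  have W_iff: "x \<in> W \<longleftrightarrow> lorentz_inner x p = 0 \<and> lorentz_inner x u = 0" for x
  proof
    assume "x \<in> W"
    then have "orthogonal (J p) x" "orthogonal (J u) x"
      unfolding W_def by (simp_all add: span_base)
    then show "lorentz_inner x p = 0 \<and> lorentz_inner x u = 0"
      by (simp add: orthogonal_def inner_J)
  next
    assume "lorentz_inner x p = 0 \<and> lorentz_inner x u = 0"
    then have "orthogonal x w" if "w \<in> {J p, J u}" for w
      using that by (auto simp: orthogonal_def inner_J inner_commute[of x])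
    then have "orthogonal x w" if "w \<in> span {J p, J u}" for w
      using orthogonal_to_span that by blast
    then show "x \<in> W" unfolding W_def by (simp add: orthogonal_commute)
  qed
  have "independent {J p, J u}"
  proof -
    have "J u \<noteq> 0" using inner_J[of u u] assms(2) by auto
    moreover have "J p \<noteq> c *\<^sub>R J u" for c
    proof
      assume "J p = c *\<^sub>R J u"
      then have "J p \<bullet> p = c * (J u \<bullet> p)" by simp
      then show False by (simp add: inner_J pp assms(3) lorentz_inner_commute[of p u])
    qed
    ultimately show ?thesis by (auto simp: independent_insert span_singleton)
  qed
  moreover have "J p \<noteq> J u"
  proof
    assume "J p = J u"
    then have "J p \<bullet> p = J u \<bullet> p" by simp
    then show False by (simp add: inner_J pp assms(3) lorentz_inner_commute[of p u])
  qed
  ultimately have "dim (span {J p, J u}) = 2"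
    by (simp add: dim_eq_card_independent)
  moreover have "dim {x \<in> UNIV. \<forall>w\<in>span {J p, J u}. orthogonal w x} + dim (span {J p, J u})
      = dim (UNIV :: 'n lorentz set)"
    by (rule dim_subspace_orthogonal_to_vectors) auto
  ultimately have "dim W = CARD('n)" by (simp add: W_def)
  moreover have "dim (range L) = CARD('n)"
    using dim_image_eq[OF assms(4), of UNIV] assms(5) by simp
  moreover have "subspace W" unfolding W_def
    by (simp add: subspace_orthogonal_to_vectors)
  moreover have "subspace (range L)" using assms(4) by (simp add: linear_subspace_image)
  moreover have "range L \<subseteq> W" using assms(6,7) by (auto simp: W_iff)
  ultimately have "range L = W" by (metis subspace_dim_equal order_refl)
  then show ?thesis using assms(8,9) by (simp add: W_iff)
qed

section \<open>Differentials on a manifold\<close>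

lemma chart_at_works:
  assumes "smooth_atlas A"
  obtains U \<phi> where "chart_at A x = (U, \<phi>)" "(U, \<phi>) \<in> A" "x \<in> U"
    "open U" "open (\<phi> ` U)" "homeomorphism U (\<phi> ` U) \<phi> (inv_into U \<phi>)"
    "inv_into U \<phi> (\<phi> x) = x"
proof -
  have "x \<in> (\<Union>c\<in>A. fst c)" using assms by (simp add: smooth_atlas_def)
  then obtain c where "c \<in> A \<and> x \<in> fst c" by blast
  then have "chart_at A x \<in> A \<and> x \<in> fst (chart_at A x)"
    unfolding chart_at_def by (rule someI)
  moreover obtain U \<phi> where U: "chart_at A x = (U, \<phi>)" by fastforce
  ultimately have "(U, \<phi>) \<in> A" "x \<in> U" by auto
  moreover from this have h: "open U \<and> open (\<phi> ` U) \<and> homeomorphism U (\<phi> ` U) \<phi> (inv_into U \<phi>)"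
    using assms by (auto simp: smooth_atlas_def)
  moreover have "inv_into U \<phi> (\<phi> x) = x"
    using h \<open>x \<in> U\<close> by (auto simp: homeomorphism_def)
  ultimately show ?thesis using that U by blast
qed

lemma smooth_on_has_derivative:
  assumes "smooth_on S f" "x \<in> S"
  shows "(f has_derivative frechet_derivative f (at x)) (at x)"
proof -
  have "Ck_on (Suc 0) S f" using assms(1) unfolding smooth_on_def by blast
  then show ?thesis using assms(2) frechet_derivative_works by auto
qed

lemma differential_has_derivative:
  assumes "smooth_atlas A" "smooth_map A f" "chart_at A x = (U, \<phi>)"
  shows "((f \<circ> inv_into U \<phi>) has_derivative differential A f x) (at (\<phi> x))"
proof -
  have "(U, \<phi>) \<in> A" "x \<in> U" using chart_at_works[OF assms(1), of x] assms(3) by auto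
  then show ?thesis
    using assms(2,3) by (auto simp: differential_def smooth_map_def intro!: smooth_on_has_derivative)
qed

lemma linear_differential:
  assumes "smooth_atlas A" "smooth_map A f"
  shows "linear (differential A f x)"
proof -
  obtain U \<phi> where c: "chart_at A x = (U, \<phi>)" by fastforce
  show ?thesis by (rule has_derivative_linear[OF differential_has_derivative[OF assms c]])
qed

lemma differential_linear_combination:
  assumes "smooth_atlas A" "smooth_map A f" "smooth_map A g"
  shows "differential A (\<lambda>x. a *\<^sub>R f x + b *\<^sub>R g x) x v
    = a *\<^sub>R differential A f x v + b *\<^sub>R differential A g x v"
proof -
  obtain U \<phi> where c: "chart_at A x = (U, \<phi>)" by fastforce
  have 1: "(((\<lambda>x. a *\<^sub>R f x + b *\<^sub>R g x) \<circ> inv_into U \<phi>) has_derivative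
      (\<lambda>v. a *\<^sub>R differential A f x v + b *\<^sub>R differential A g x v)) (at (\<phi> x))"
    using differential_has_derivative[OF assms(1,2) c] differential_has_derivative[OF assms(1,3) c]
    unfolding o_def by (intro derivative_intros)
  have 2: "(((\<lambda>x. a *\<^sub>R f x + b *\<^sub>R g x) \<circ> inv_into U \<phi>) has_derivative
      differential A (\<lambda>x. a *\<^sub>R f x + b *\<^sub>R g x) x) (at (\<phi> x))"
    by (rule differential_has_derivative[OF assms(1) smooth_map_linear_combination[OF assms] c])
  show ?thesis by (rule fun_cong[OF has_derivative_unique[OF 2 1]])
qed

lemma differential_lorentz_inner_constant:
  assumes "smooth_atlas A" "smooth_map A f" "smooth_map A g"
    and "\<And>x. lorentz_inner (f x) (g x) = c"
  shows "lorentz_inner (differential A f x v) (g x) + lorentz_inner (f x) (differential A g x v) = 0"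
proof -
  obtain U \<phi> where ch: "chart_at A x = (U, \<phi>)" "(U, \<phi>) \<in> A" "x \<in> U"
    "open U" "open (\<phi> ` U)" "homeomorphism U (\<phi> ` U) \<phi> (inv_into U \<phi>)"
    "inv_into U \<phi> (\<phi> x) = x"
    by (rule chart_at_works[OF assms(1), of x])
  have 1: "((\<lambda>y. lorentz_inner ((f \<circ> inv_into U \<phi>) y) ((g \<circ> inv_into U \<phi>) y)) has_derivative
    (\<lambda>v. lorentz_inner ((f \<circ> inv_into U \<phi>) (\<phi> x)) (differential A g x v)
        + lorentz_inner (differential A f x v) ((g \<circ> inv_into U \<phi>) (\<phi> x)))) (at (\<phi> x))"
    by (rule bounded_bilinear.FDERIV[OF bounded_bilinear_lorentz_inner
        differential_has_derivative[OF assms(1,2) ch(1)] differential_has_derivative[OF assms(1,3) ch(1)]])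
  have 2: "((\<lambda>y. lorentz_inner ((f \<circ> inv_into U \<phi>) y) ((g \<circ> inv_into U \<phi>) y)) has_derivative
    (\<lambda>v. 0)) (at (\<phi> x))"
    by (simp add: assms(4))
  show ?thesis
    using fun_cong[OF has_derivative_unique[OF 1 2], of v] ch(7) by (simp add: add.commute)
qed

text \<open>The differential at a point is taken in the one chart selected there, and the selection may
  jump from point to point.  To argue in a fixed chart around nearby points, the chain
  rule with the smooth change of charts is needed.\<close>

lemma zero_differential_any_chart:
  assumes "smooth_atlas A" "smooth_map A f" "differential A f x = (\<lambda>v. 0)"
    and "(V, \<psi>) \<in> A" "x \<in> V"
  shows "((f \<circ> inv_into V \<psi>) has_derivative (\<lambda>v. 0)) (at (\<psi> x))"
proof -
  obtain U \<phi> where ch: "chart_at A x = (U, \<phi>)" "(U, \<phi>) \<in> A" "x \<in> U"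
    "open U" "open (\<phi> ` U)" "homeomorphism U (\<phi> ` U) \<phi> (inv_into U \<phi>)"
    "inv_into U \<phi> (\<phi> x) = x"
    by (rule chart_at_works[OF assms(1), of x])
  have V: "open (\<psi> ` V)" "homeomorphism V (\<psi> ` V) \<psi> (inv_into V \<psi>)"
    using assms(1,4) by (auto simp: smooth_atlas_def)
  have inj: "inj_on \<psi> V" "inj_on \<phi> U"
    using V(2) ch(6) homeomorphism_apply1 inj_on_inverseI by metis+
  have opn: "open (\<psi> ` (V \<inter> U))"
  proof -
    have "openin (top_of_set (\<psi> ` V)) (\<psi> ` (V \<inter> U))"
      using homeomorphism_imp_open_map[OF V(2), of "V \<inter> U"] ch(4) by (auto simp: openin_open)
    then show ?thesis using V(1) openin_open_eq by blast
  qed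
  have sm: "smooth_on (\<psi> ` (V \<inter> U)) (\<phi> \<circ> inv_into V \<psi>)"
    using assms(1,4) ch(2) unfolding smooth_atlas_def by blast
  have invx: "inv_into V \<psi> (\<psi> x) = x" using inj(1) assms(5) by simp
  define T where "T = \<phi> \<circ> inv_into V \<psi>"
  have T: "(T has_derivative frechet_derivative T (at (\<psi> x))) (at (\<psi> x))"
    using smooth_on_has_derivative[OF sm] assms(5) ch(3) unfolding T_def by blast
  have "T (\<psi> x) = \<phi> x" by (simp add: T_def invx)
  then have "((f \<circ> inv_into U \<phi>) has_derivative (\<lambda>v. 0)) (at (T (\<psi> x)))"
    using differential_has_derivative[OF assms(1,2) ch(1)] assms(3) by simp
  from diff_chain_at[OF T this]
  have "(((f \<circ> inv_into U \<phi>) \<circ> T) has_derivative (\<lambda>v. 0)) (at (\<psi> x))"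
    by (simp add: o_def)
  moreover have "((f \<circ> inv_into U \<phi>) \<circ> T) y = (f \<circ> inv_into V \<psi>) y" if "y \<in> \<psi> ` (V \<inter> U)" for y
    using that inj by (auto simp: T_def)
  ultimately show ?thesis
    using has_derivative_transform_within_open[OF _ opn] assms(5) ch(3) by blast
qed

text \<open>In a chart the map has zero derivative on a ball, so it is locally constant; every preimage of a
  set is then open, and connectedness leaves a single value.\<close>

lemma zero_differential_imp_constant:
  fixes A :: "('m::topological_space, 'n::finite) chart set"
    and f :: "'m \<Rightarrow> 'b::real_normed_vector"
  assumes "smooth_atlas A" "connected (UNIV :: 'm set)" "smooth_map A f"
    and "\<And>x. differential A f x = (\<lambda>v. 0)"
  shows "f x = f y"
proof -
  have loc: "\<exists>B. open B \<and> z \<in> B \<and> (\<forall>w\<in>B. f w = f z)" for z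
  proof -
    obtain U \<phi> where ch: "chart_at A z = (U, \<phi>)" "(U, \<phi>) \<in> A" "z \<in> U"
    "open U" "open (\<phi> ` U)" "homeomorphism U (\<phi> ` U) \<phi> (inv_into U \<phi>)"
    "inv_into U \<phi> (\<phi> z) = z"
    by (rule chart_at_works[OF assms(1), of z])
    have "\<phi> z \<in> \<phi> ` U" using ch(3) by blast
    then obtain e where e: "e > 0" "ball (\<phi> z) e \<subseteq> \<phi> ` U"
      using openE[OF ch(5)] by blast
    define B where "B = U \<inter> \<phi> -` ball (\<phi> z) e"
    have "continuous_on U \<phi>" using ch(6) by (simp add: homeomorphism_def)
    then have "open B" unfolding B_def
      using continuous_open_preimage[OF _ ch(4) open_ball] by blast
    moreover have "z \<in> B" using ch(3) e(1) by (simp add: B_def)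
    moreover have "f w = f z" if "w \<in> B" for w
    proof -
      have inv: "inv_into U \<phi> (\<phi> a) = a" if "a \<in> U" for a
        using ch(6) that by (auto simp: homeomorphism_def)
      have "((f \<circ> inv_into U \<phi>) has_derivative (\<lambda>v. 0)) (at a)" if "a \<in> ball (\<phi> z) e" for a
      proof -
        have "a \<in> \<phi> ` U" by (rule subsetD[OF e(2) that])
        then obtain b where b: "a = \<phi> b" "b \<in> U" by (rule imageE)
        show ?thesis unfolding b(1)
          by (rule zero_differential_any_chart[OF assms(1,3,4) ch(2) b(2)])
      qed
      then have "\<exists>c. \<forall>a\<in>ball (\<phi> z) e. (f \<circ> inv_into U \<phi>) a = c"
        by (intro has_derivative_zero_constant convex_ball) (rule has_derivative_at_withinI)
      then have "(f \<circ> inv_into U \<phi>) (\<phi> w) = (f \<circ> inv_into U \<phi>) (\<phi> z)"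
        using that e(1) unfolding B_def by (metis IntE centre_in_ball vimageE)
      then show ?thesis using that ch(3) by (simp add: inv B_def)
    qed
    ultimately show ?thesis by blast
  qed
  have "open (f -` Y)" for Y
    unfolding open_subopen[of "f -` Y"] using loc by (metis subsetI vimageE vimageI)
  then have "UNIV \<subseteq> f -` {f y} \<or> UNIV \<subseteq> f -` (- {f y})"
    using connectedD[OF assms(2), of "f -` {f y}" "f -` (- {f y})"] by blast
  then show ?thesis by blast
qed

section \<open>Umbilic hypersurfaces and their parallel hypersurfaces\<close>

lemma differential_hypersurface_tangent:
  assumes "smooth_atlas A" "hypersurface A F"
  shows "lorentz_inner (differential A F x v) (F x) = 0"
proof -
  have "smooth_map A F" and "lorentz_inner (F x) (F x) = -1" for x
    using assms(2) by (auto simp: hypersurface_def hyperbolic_space_def)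
  from differential_lorentz_inner_constant[OF assms(1) this(1,1) this(2)] show ?thesis
    by (simp add: lorentz_inner_commute)
qed

lemma induced_metric_pos:
  assumes "smooth_atlas A" "hypersurface A F" "v \<noteq> 0"
  shows "induced_metric A F x v v > 0"
proof -
  have F: "smooth_map A F" "F x \<in> hyperbolic_space" "inj (differential A F x)"
    using assms(2) by (auto simp: hypersurface_def)
  have "differential A F x v \<noteq> 0"
    using linear_injective_0[OF linear_differential[OF assms(1) F(1)]] F(3) assms(3) by blast
  then show ?thesis unfolding induced_metric_def
    by (intro hyperbolic_tangent_pos[OF F(2)] differential_hypersurface_tangent[OF assms(1,2)])
qed

lemma mean_curvature_umbilic:
  fixes F :: "'m::topological_space \<Rightarrow> 'n::finite lorentz"
  assumes "smooth_atlas A" "hypersurface A F"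
    and II: "\<And>v w. second_fundamental_form A F N x v w = c * induced_metric A F x v w"
  shows "principal_curvatures A F N x = {c}"
    and "mean_curvature A F N x = real CARD('n) * c"
proof -
  have E: "curvature_eigenspace A F N x c = UNIV"
    by (simp add: curvature_eigenspace_def II)
  obtain b :: "real ^ 'n" where "b \<noteq> 0"
    using nonempty_Basis nonzero_Basis by blast
  then have "c \<in> principal_curvatures A F N x"
    unfolding principal_curvatures_def using E by blast
  moreover have "\<kappa> = c" if \<kappa>: "\<kappa> \<in> principal_curvatures A F N x" for \<kappa>
  proof -
    obtain v where "v \<noteq> 0" "v \<in> curvature_eigenspace A F N x \<kappa>"
      using \<kappa> unfolding principal_curvatures_def by blast
    then have v: "c * induced_metric A F x v w = \<kappa> * induced_metric A F x v w" for w
      unfolding curvature_eigenspace_def II by blast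
    then show ?thesis
      using induced_metric_pos[OF assms(1,2) \<open>v \<noteq> 0\<close>, of x] v[of v] by simp
  qed
  ultimately show *: "principal_curvatures A F N x = {c}" by blast
  show "mean_curvature A F N x = real CARD('n) * c"
    by (simp add: mean_curvature_def * E)
qed

text \<open>The umbilic condition only controls \<open>dN + c dF\<close> against tangent vectors.  The normalisations
  of \<open>N\<close> make this vector orthogonal to \<open>F\<close> and \<open>N\<close> as well, so it is itself tangent, hence
  orthogonal to itself, and it vanishes because the tangent space is spacelike.\<close>

lemma umbilic_shape_operator:
  assumes "smooth_atlas A" "hypersurface A F" "unit_normal A F N"
    and II: "\<And>v w. second_fundamental_form A F N x v w = c * induced_metric A F x v w"
  shows "differential A N x v = - (c *\<^sub>R differential A F x v)"
proof -
  have F: "smooth_map A F" "F x \<in> hyperbolic_space" "inj (differential A F x)"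
    using assms(2) by (auto simp: hypersurface_def)
  have N: "smooth_map A N" "\<And>x. lorentz_inner (N x) (N x) = 1" "\<And>x. lorentz_inner (N x) (F x) = 0"
    "\<And>v. lorentz_inner (N x) (differential A F x v) = 0"
    using assms(3) by (auto simp: unit_normal_def)
  note dF = differential_hypersurface_tangent[OF assms(1,2)]
  define y where "y = differential A N x v + c *\<^sub>R differential A F x v"
  have dNN: "lorentz_inner (differential A N x v) (N x) = 0"
    using differential_lorentz_inner_constant[OF assms(1) N(1,1) N(2)]
    by (simp add: lorentz_inner_commute)
  have dNF: "lorentz_inner (differential A N x v) (F x) = 0"
    using differential_lorentz_inner_constant[OF assms(1) N(1) F(1) N(3), where v=v and x=x] N(4)[of v] by simp
  have yF: "lorentz_inner y (F x) = 0" by (simp add: y_def lorentz_simps dNF dF)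
  moreover have "lorentz_inner y (N x) = 0"
    using N(4) dNN by (simp add: y_def lorentz_simps lorentz_inner_commute)
  ultimately have "y \<in> range (differential A F x)"
    using N dF linear_differential[OF assms(1) F(1)]
    by (intro hypersurface_tangent_space[OF F(2) N(2) N(3) _ F(3)])
      (auto simp: lorentz_inner_commute)
  then obtain w where w: "y = differential A F x w" by blast
  have "lorentz_inner y (differential A F x w) = 0"
    using II[of v w]
    by (simp add: y_def lorentz_simps second_fundamental_form_def induced_metric_def)
  then have "y = 0" using hyperbolic_tangent_pos[OF F(2) yF] w by force
  then show ?thesis by (simp add: y_def eq_neg_iff_add_eq_0)
qed

text \<open>The umbilic condition enters in the integrated form \<open>dN = - k dF\<close> with one constant \<open>k\<close>;
  everything about parallel hypersurfaces follows from it by linear algebra in the frame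
  \<open>(F, N)\<close>.\<close>

locale umbilic_hypersurface =
  fixes A :: "('m::topological_space, 'n::finite) chart set"
    and F N :: "'m \<Rightarrow> 'n lorentz" and k :: real
  assumes atlas: "smooth_atlas A"
    and hypersurface: "hypersurface A F"
    and normal: "unit_normal A F N"
    and shape: "\<And>x v. differential A N x v = - (k *\<^sub>R differential A F x v)"
begin

text \<open>For \<open>a\<^sup>2 - b\<^sup>2 = 1\<close>, \<open>a > 0\<close> and \<open>a \<noteq> b k\<close> this is a parallel hypersurface and the combination with swapped
  coefficients is its normal; keeping the coefficients free treats both, and
  the limits of the flow, at once.\<close>

definition combination :: "real \<Rightarrow> real \<Rightarrow> 'm \<Rightarrow> 'n lorentz" where
  "combination a b x = a *\<^sub>R F x + b *\<^sub>R N x"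

lemma smooth_F: "smooth_map A F" and F_in: "F x \<in> hyperbolic_space"
  using hypersurface by (auto simp: hypersurface_def)

lemma smooth_N: "smooth_map A N"
  using normal by (simp add: unit_normal_def)

lemma frame_products [simp]:
  "lorentz_inner (F x) (F x) = -1" "lorentz_inner (N x) (N x) = 1"
  "lorentz_inner (N x) (F x) = 0" "lorentz_inner (F x) (N x) = 0"
  "lorentz_inner (N x) (differential A F x v) = 0" "lorentz_inner (F x) (differential A F x v) = 0"
  using F_in[of x] normal differential_hypersurface_tangent[OF atlas hypersurface, of x v]
  by (auto simp: hyperbolic_space_def unit_normal_def lorentz_inner_commute)

lemma combination_products:
  "lorentz_inner (combination a b x) (combination c d x) = b * d - a * c"
  "lorentz_inner (combination a b x) (differential A F x v) = 0"
  by (simp_all add: combination_def lorentz_simps algebra_simps)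

lemma smooth_combination: "smooth_map A (combination a b)"
  unfolding combination_def by (rule smooth_map_linear_combination[OF atlas smooth_F smooth_N])

lemma differential_combination:
  "differential A (combination a b) x v = (a - b * k) *\<^sub>R differential A F x v"
  unfolding combination_def
  by (simp add: differential_linear_combination[OF atlas smooth_F smooth_N] shape algebra_simps)

lemma time_coordinates: "\<bar>fst (N x)\<bar> < fst (F x)"
  by (rule unit_tangent_time_coordinate[OF F_in]) simp_all

lemma time_combination_ge:
  assumes "\<bar>b\<bar> \<le> a"
  shows "fst (combination a b x) \<ge> a * (fst (F x) - \<bar>fst (N x)\<bar>)"
proof -
  have "\<bar>b * fst (N x)\<bar> \<le> a * \<bar>fst (N x)\<bar>"
    unfolding abs_mult by (rule mult_right_mono[OF assms]) simp
  then have "- (b * fst (N x)) \<le> a * \<bar>fst (N x)\<bar>" by linarith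
  then show ?thesis by (simp add: combination_def algebra_simps)
qed

lemma combination_in_hyperbolic_space:
  assumes "a\<^sup>2 - b\<^sup>2 = 1" "a > 0"
  shows "combination a b x \<in> hyperbolic_space"
proof -
  have "b\<^sup>2 \<le> a\<^sup>2" using assms(1) by linarith
  then have "\<bar>b\<bar> \<le> a" using assms(2) by (simp add: abs_le_square_iff[symmetric])
  moreover have "a * (fst (F x) - \<bar>fst (N x)\<bar>) > 0" using assms(2) time_coordinates[of x] by simp
  ultimately have "fst (combination a b x) > 0" using time_combination_ge[of b a x] by linarith
  then show ?thesis
    using assms(1) by (simp add: hyperbolic_space_def combination_products power2_eq_square)
qed

lemma hypersurface_combination:
  assumes "a\<^sup>2 - b\<^sup>2 = 1" "a > 0" "a - b * k \<noteq> 0"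
  shows "hypersurface A (combination a b)"
proof -
  have "inj (differential A F x)" for x using hypersurface by (simp add: hypersurface_def)
  then have "inj (differential A (combination a b) x)" for x
    using assms(3) by (simp add: inj_def differential_combination)
  then show ?thesis
    by (simp add: hypersurface_def smooth_combination combination_in_hyperbolic_space[OF assms(1,2)])
qed

text \<open>The focal case \<open>a = b k\<close> is excluded for any parallel hypersurface that is an immersion, so the
  mean curvature formula below may divide by \<open>a - b k\<close> without a separate hypothesis.\<close>

lemma hypersurface_combination_nondegenerate:
  assumes "hypersurface A (combination a b)"
  shows "a - b * k \<noteq> 0"
proof
  assume "a - b * k = 0"
  then have "differential A (combination a b) x v = 0" for x v
    by (simp add: differential_combination)
  moreover have "inj (differential A (combination a b) x)" for x
    using assms by (simp add: hypersurface_def)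
  moreover obtain v :: "real ^ 'n" where "v \<noteq> 0"
    using nonempty_Basis nonzero_Basis by blast
  ultimately show False unfolding inj_def by metis
qed

lemma unit_normal_combination:
  assumes "a\<^sup>2 - b\<^sup>2 = 1"
  shows "unit_normal A (combination a b) (combination b a)"
  using assms
  by (simp add: unit_normal_def smooth_combination combination_products differential_combination
      lorentz_simps power2_eq_square)

lemma second_fundamental_form_combination:
  "second_fundamental_form A (combination a b) (combination c d) x v w
    = (d * k - c) * (a - b * k) * induced_metric A F x v w"
proof -
  have "second_fundamental_form A (combination a b) (combination c d) x v w
      = - ((c - d * k) * ((a - b * k) * induced_metric A F x v w))"
    unfolding second_fundamental_form_def induced_metric_def differential_combination lorentz_simps
    by simp
  then show ?thesis by (simp add: algebra_simps)
qed

text \<open>The field \<open>combination c d\<close> is left arbitrary.  With \<open>c = b\<close>, \<open>d = a\<close> it is one unit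
  normal, with \<open>c = - b\<close>, \<open>d = - a\<close> the other; the uniqueness argument has to consider
  both.\<close>

lemma mean_curvature_combination:
  assumes "hypersurface A (combination a b)"
  shows "mean_curvature A (combination a b) (combination c d) x
    = real CARD('n) * ((d * k - c) / (a - b * k))"
proof (rule mean_curvature_umbilic(2)[OF atlas assms])
  fix v w
  have "induced_metric A (combination a b) x v w
      = (a - b * k) * ((a - b * k) * induced_metric A F x v w)"
    unfolding induced_metric_def differential_combination lorentz_simps by simp
  then show "second_fundamental_form A (combination a b) (combination c d) x v w
      = (d * k - c) / (a - b * k) * induced_metric A (combination a b) x v w"
    unfolding second_fundamental_form_combination
    using hypersurface_combination_nondegenerate[OF assms] by simp
qed

end

section \<open>The distance function of the flow\<close>

text \<open>The function \<open>q\<close> of the flow; its square root is the value of \<open>k cosh \<mu> - sinh \<mu>\<close> along the flow.\<close>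

definition flow_discriminant :: "real \<Rightarrow> real \<Rightarrow> real \<Rightarrow> real" where
  "flow_discriminant n k t = exp (2 * t / n) + k\<^sup>2 - 1"

text \<open>Adding \<open>cosh \<mu> - k sinh \<mu> = exp (t / n)\<close> and \<open>k cosh \<mu> - sinh \<mu> = sqrt (q t)\<close> gives
  \<open>(1 + k) exp (- \<mu>)\<close>, which is this closed form of the signed distance \<open>\<mu>\<close>.\<close>

definition flow_distance :: "real \<Rightarrow> real \<Rightarrow> real \<Rightarrow> real" where
  "flow_distance n k t = ln ((1 + k) / (exp (t / n) + sqrt (flow_discriminant n k t)))"

definition flow_domain :: "real \<Rightarrow> real \<Rightarrow> real set" where
  "flow_domain n k = {t. flow_discriminant n k t > 0}"

lemma flow_discriminant_exp: "flow_discriminant n k t = (exp (t / n))\<^sup>2 + k\<^sup>2 - 1"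
  by (simp add: flow_discriminant_def exp_double[symmetric])

lemma cosh_sinh_flow_distance:
  assumes "k > 0" "k \<noteq> 1" "t \<in> flow_domain n k"
  shows "cosh (flow_distance n k t) = (exp (t / n) - k * sqrt (flow_discriminant n k t)) / (1 - k\<^sup>2)"
    and "sinh (flow_distance n k t) = (k * exp (t / n) - sqrt (flow_discriminant n k t)) / (1 - k\<^sup>2)"
proof -
  define E s where "E = exp (t / n)" and "s = sqrt (flow_discriminant n k t)"
  have "flow_discriminant n k t > 0" using assms(3) by (simp add: flow_domain_def)
  then have s: "s > 0" "s\<^sup>2 = E\<^sup>2 + k\<^sup>2 - 1"
    by (simp_all add: s_def E_def flow_discriminant_exp)
  have E: "E > 0" by (simp add: E_def)
  have k2: "1 - k\<^sup>2 = (1 - k) * (1 + k)" by (simp add: power2_eq_square algebra_simps)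
  have nz: "1 - k \<noteq> 0" "1 + k \<noteq> 0" "E + s \<noteq> 0" using assms s E by auto
  \<comment> \<open>The discriminant is chosen so that \<open>exp \<mu>\<close> and \<open>exp (- \<mu>)\<close> are both linear in \<open>E\<close> and \<open>s\<close>.\<close>
  have "(1 + k) * (1 - k) = (E - s) * (E + s)"
    using s(2) by (simp add: power2_eq_square algebra_simps)
  then have x: "(1 + k) / (E + s) = (E - s) / (1 - k)"
    using nz by (simp add: frac_eq_eq)
  have pos: "(1 + k) / (E + s) > 0" using assms s E by simp
  have d: "flow_distance n k t = ln ((1 + k) / (E + s))"
    by (simp add: flow_distance_def E_def s_def)
  have half: "2 * x / y / 2 = x / y" for x y :: real by simp
  have "cosh (flow_distance n k t) = ((E - s) / (1 - k) + (E + s) / (1 + k)) / 2"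
    unfolding d cosh_ln_real[OF pos] inverse_divide by (simp add: x)
  also have "\<dots> = (2 * (E - k * s) / ((1 - k) * (1 + k))) / 2"
  proof -
    have num: "(E - s) * (1 + k) + (E + s) * (1 - k) = 2 * (E - k * s)" by (simp add: algebra_simps)
    show ?thesis unfolding add_frac_eq[OF nz(1,2)] num ..
  qed
  also have "\<dots> = (E - k * s) / (1 - k\<^sup>2)" unfolding half k2 ..
  finally show "cosh (flow_distance n k t) = (exp (t / n) - k * sqrt (flow_discriminant n k t)) / (1 - k\<^sup>2)"
    by (simp add: E_def s_def)
  have "sinh (flow_distance n k t) = ((E - s) / (1 - k) - (E + s) / (1 + k)) / 2"
    unfolding d sinh_ln_real[OF pos] inverse_divide by (simp add: x)
  also have "\<dots> = (2 * (k * E - s) / ((1 - k) * (1 + k))) / 2"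
  proof -
    have num: "(E - s) * (1 + k) - (E + s) * (1 - k) = 2 * (k * E - s)" by (simp add: algebra_simps)
    show ?thesis unfolding diff_frac_eq[OF nz(1,2)] num ..
  qed
  also have "\<dots> = (k * E - s) / (1 - k\<^sup>2)" unfolding half k2 ..
  finally show "sinh (flow_distance n k t) = (k * exp (t / n) - sqrt (flow_discriminant n k t)) / (1 - k\<^sup>2)"
    by (simp add: E_def s_def)
qed

text \<open>These two combinations are the factor by which the differential of \<open>F\<close> is scaled along the flow,
  vanishing at a focal point, and minus the factor by which \<open>dF\<close> is scaled to give the
  differential of the normal.  The second divided by the first is the principal curvature.\<close>

lemma flow_distance_focal:
  assumes "k > 0" "k \<noteq> 1" "t \<in> flow_domain n k"
  shows "cosh (flow_distance n k t) - sinh (flow_distance n k t) * k = exp (t / n)"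
    and "cosh (flow_distance n k t) * k - sinh (flow_distance n k t) = sqrt (flow_discriminant n k t)"
proof -
  have nz: "1 - k\<^sup>2 \<noteq> 0" using assms(1,2) power2_eq_1_iff[of k] by auto
  show "cosh (flow_distance n k t) - sinh (flow_distance n k t) * k = exp (t / n)"
    "cosh (flow_distance n k t) * k - sinh (flow_distance n k t) = sqrt (flow_discriminant n k t)"
    unfolding cosh_sinh_flow_distance[OF assms] times_divide_eq_left diff_divide_distrib[symmetric]
    using nz by (simp_all add: divide_eq_eq) (simp_all add: power2_eq_square algebra_simps)
qed

lemma flow_domain_zero: "k > 0 \<Longrightarrow> 0 \<in> flow_domain n k"
  by (simp add: flow_domain_def flow_discriminant_def)

lemma flow_distance_zero: "k > 0 \<Longrightarrow> flow_distance n k 0 = 0"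
  by (simp add: flow_distance_def flow_discriminant_def)

lemma flow_domain_greaterThan:
  assumes "n > 0" "0 < k" "k < 1"
  shows "flow_domain n k = {n / 2 * ln (1 - k\<^sup>2) <..}"
proof -
  have pos: "1 - k\<^sup>2 > 0" using assms by (simp add: power_less_one_iff)
  have "flow_discriminant n k t > 0 \<longleftrightarrow> n / 2 * ln (1 - k\<^sup>2) < t" for t
  proof -
    have "flow_discriminant n k t > 0 \<longleftrightarrow> 1 - k\<^sup>2 < exp (2 * t / n)"
      unfolding flow_discriminant_def by linarith
    also have "\<dots> \<longleftrightarrow> ln (1 - k\<^sup>2) < 2 * t / n"
      using ln_less_cancel_iff[OF pos exp_gt_zero, of "2 * t / n"] by simp
    also have "\<dots> \<longleftrightarrow> ln (1 - k\<^sup>2) * n < 2 * t" by (rule pos_less_divide_eq[OF assms(1)])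
    also have "\<dots> \<longleftrightarrow> n / 2 * ln (1 - k\<^sup>2) < t" by (simp add: mult.commute)
    finally show ?thesis .
  qed
  then show ?thesis unfolding flow_domain_def by blast
qed

lemma flow_domain_UNIV:
  assumes "k > 1"
  shows "flow_domain n k = UNIV"
proof -
  have "k\<^sup>2 > 1" using assms by (simp add: one_less_power)
  then have "flow_discriminant n k t > 0" for t
    unfolding flow_discriminant_def using exp_gt_zero[of "2 * t / n"] by linarith
  then show ?thesis by (simp add: flow_domain_def)
qed

lemma open_interval_flow_domain:
  assumes "n > 0" "k > 0" "k \<noteq> 1"
  shows "open (flow_domain n k)" "is_interval (flow_domain n k)"
proof -
  have "open (flow_domain n k) \<and> is_interval (flow_domain n k)"
  proof (cases "k < 1")
    case True
    show ?thesis unfolding flow_domain_greaterThan[OF assms(1,2) True] by simp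
  next
    case False
    then have "k > 1" using assms(3) by simp
    then show ?thesis by (simp add: flow_domain_UNIV)
  qed
  then show "open (flow_domain n k)" "is_interval (flow_domain n k)" by simp_all
qed

lemma sqrt_flow_discriminant_has_derivative:
  assumes "n > 0" "t \<in> flow_domain n k"
  shows "((\<lambda>t. sqrt (flow_discriminant n k t)) has_real_derivative
    (exp (t / n))\<^sup>2 / (n * sqrt (flow_discriminant n k t))) (at t)"
proof -
  have pos: "flow_discriminant n k t > 0" using assms(2) by (simp add: flow_domain_def)
  have "((\<lambda>t. flow_discriminant n k t) has_real_derivative 2 * (exp (t / n))\<^sup>2 / n) (at t)"
    unfolding flow_discriminant_exp using assms(1)
    by (auto intro!: derivative_eq_intros simp: power2_eq_square)
  from DERIV_chain2[where f=sqrt and g="flow_discriminant n k", OF DERIV_real_sqrt[OF pos] this] show ?thesis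
    using assms(1) pos by (simp add: field_simps)
qed

lemma flow_distance_has_derivative:
  assumes "n > 0" "k > 0" "t \<in> flow_domain n k"
  shows "(flow_distance n k has_real_derivative
    - (exp (t / n) / (n * sqrt (flow_discriminant n k t)))) (at t)"
proof -
  define E s where "E = exp (t / n)" and "s = sqrt (flow_discriminant n k t)"
  have s: "s > 0" using assms(3) by (simp add: s_def flow_domain_def)
  have E: "E > 0" by (simp add: E_def)
  have "((\<lambda>t. exp (t / n) + sqrt (flow_discriminant n k t)) has_real_derivative
      E / n + E\<^sup>2 / (n * s)) (at t)"
  proof (intro DERIV_add)
    show "((\<lambda>t. exp (t / n)) has_real_derivative E / n) (at t)"
      unfolding E_def using assms(1) by (auto intro!: derivative_eq_intros)
  qed (use sqrt_flow_discriminant_has_derivative[OF assms(1,3)] in \<open>simp add: E_def s_def\<close>)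
  from DERIV_divide[OF DERIV_const[of "1 + k"] this]
  have "((\<lambda>t. (1 + k) / (exp (t / n) + sqrt (flow_discriminant n k t))) has_real_derivative
      - ((1 + k) * (E / n + E\<^sup>2 / (n * s)) / (E + s)\<^sup>2)) (at t)"
    using s E by (simp add: E_def[symmetric] s_def[symmetric] power2_eq_square)
  from DERIV_chain2[where f=ln, OF DERIV_ln_divide this]
  have "(flow_distance n k has_real_derivative
      1 / ((1 + k) / (E + s)) * - ((1 + k) * (E / n + E\<^sup>2 / (n * s)) / (E + s)\<^sup>2)) (at t)"
    unfolding flow_distance_def[abs_def] using s E assms(2)
    by (simp add: E_def[symmetric] s_def[symmetric])
  moreover have "1 / ((1 + k) / (E + s)) * - ((1 + k) * (E / n + E\<^sup>2 / (n * s)) / (E + s)\<^sup>2)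
      = - (E / (n * s))"
  proof -
    have "E / n + E\<^sup>2 / (n * s) = E * (E + s) / (n * s)"
      using s assms(1) by (simp add: field_simps power2_eq_square)
    moreover have "E + s \<noteq> 0" "1 + k \<noteq> 0" using s E assms(2) by auto
    ultimately show ?thesis by (simp add: power2_eq_square)
  qed
  ultimately show ?thesis unfolding E_def s_def by simp
qed

lemma Ck_on_Suc_real_I:
  fixes f :: "real \<Rightarrow> real"
  assumes "open S" "\<And>t. t \<in> S \<Longrightarrow> (f has_real_derivative g t) (at t)" "Ck_on j S g"
  shows "Ck_on (Suc j) S f"
proof (rule Ck_on_Suc_I[OF assms(1)])
  show "(f has_derivative (\<lambda>v. v *\<^sub>R g t)) (at t)" if "t \<in> S" for t
    using assms(2)[OF that] by (simp add: has_field_derivative_def mult.commute[of _ "g t"])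
  show "Ck_on j S (\<lambda>t. v *\<^sub>R g t)" for v
    by (rule Ck_on_scaleR[OF assms(1) Ck_on_const[OF assms(1)] assms(3)])
qed

text \<open>The derivative is a multiple of \<open>exp (t / n) * r\<close> with \<open>r = 1 / sqrt q\<close>.  Both factors satisfy
  differential equations that are polynomial in the two of them, so each order of
  differentiability implies the next.\<close>

lemma smooth_flow_distance:
  assumes "n > 0" "k > 0" "k \<noteq> 1"
  shows "smooth_on (flow_domain n k) (flow_distance n k)"
proof -
  let ?S = "flow_domain n k"
  have S: "open ?S" by (rule open_interval_flow_domain[OF assms])
  have pos: "sqrt (flow_discriminant n k t) > 0" if "t \<in> ?S" for t
    using that by (simp add: flow_domain_def)
  note intros = Ck_on_scaleR[OF S, where 'b=real, unfolded real_scaleR_def] Ck_on_const[OF S]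
  have E: "Ck_on j ?S (\<lambda>t. exp (t / n))" for j
  proof (induction j)
    case 0
    show ?case using assms(1) by (auto intro!: continuous_intros)
  next
    case (Suc j)
    have "((\<lambda>t. exp (t / n)) has_real_derivative (1 / n) * exp (t / n)) (at t)" for t
      using assms(1) by (auto intro!: derivative_eq_intros)
    then show ?case by (rule Ck_on_Suc_real_I[OF S]) (intro intros Suc)
  qed
  define r where "r t = inverse (sqrt (flow_discriminant n k t))" for t
  have r': "(r has_real_derivative (- (1 / n)) * (exp (t / n) * (exp (t / n) * (r t * (r t * r t))))) (at t)"
    if "t \<in> ?S" for t
  proof -
    have "(r has_real_derivative
      - (inverse (sqrt (flow_discriminant n k t)) * ((exp (t / n))\<^sup>2 / (n * sqrt (flow_discriminant n k t)))
        * inverse (sqrt (flow_discriminant n k t)))) (at t)"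
      unfolding r_def[abs_def] using pos[OF that]
      by (intro DERIV_inverse' sqrt_flow_discriminant_has_derivative assms that) simp
    then show ?thesis by (simp add: r_def field_simps power2_eq_square)
  qed
  have r: "Ck_on j ?S r" for j
  proof (induction j)
    case 0
    have "isCont r t" if "t \<in> ?S" for t using r'[OF that] by (rule DERIV_isCont)
    then show ?case by (simp add: continuous_at_imp_continuous_on)
  next
    case (Suc j)
    show ?case by (rule Ck_on_Suc_real_I[OF S r']) (assumption, intro intros Suc E)
  qed
  have "Ck_on (Suc j) ?S (flow_distance n k)" for j
  proof (rule Ck_on_Suc_real_I[OF S])
    show "(flow_distance n k has_real_derivative (- (1 / n)) * (exp (t / n) * r t)) (at t)"
      if "t \<in> ?S" for t
      using flow_distance_has_derivative[OF assms(1,2) that] by (simp add: r_def field_simps)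
    show "Ck_on j ?S (\<lambda>t. (- (1 / n)) * (exp (t / n) * r t))" by (intro intros E r)
  qed
  then show ?thesis unfolding smooth_on_def using Ck_on_Suc_imp_Ck_on by blast
qed

text \<open>The function \<open>c = cosh \<nu> - k sinh \<nu>\<close> satisfies the linear equation \<open>c' = c / n\<close>, and
  \<open>d = k cosh \<nu> - sinh \<nu>\<close> is tied to it by \<open>d\<^sup>2 - c\<^sup>2 = k\<^sup>2 - 1\<close>.  Only the sign of \<open>d\<close> is left
  open; \<open>d\<close> never vanishes on the interval and starts at \<open>k > 0\<close>.  Since \<open>d\<^sup>2\<close> is the discriminant,
  no solution can leave the set on which the discriminant is positive.\<close>

lemma flow_distance_unique:
  assumes "n > 0" "k > 0" "k \<noteq> 1"
    and J: "is_interval J" "0 \<in> J" and "\<nu> 0 = 0"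
    and ode: "\<And>t. t \<in> J \<Longrightarrow> (\<nu> has_real_derivative
      - ((cosh (\<nu> t) - sinh (\<nu> t) * k) / (n * (cosh (\<nu> t) * k - sinh (\<nu> t))))) (at t)"
    and nz: "\<And>t. t \<in> J \<Longrightarrow> cosh (\<nu> t) * k - sinh (\<nu> t) \<noteq> 0"
    and "t \<in> J"
  shows "t \<in> flow_domain n k \<and> \<nu> t = flow_distance n k t"
proof -
  define c d where "c t = cosh (\<nu> t) - sinh (\<nu> t) * k" and "d t = cosh (\<nu> t) * k - sinh (\<nu> t)" for t
  have convex: "convex J" using J(1) by (simp add: is_interval_convex_1)
  have d_nz: "d t \<noteq> 0" if "t \<in> J" for t using nz[OF that] by (simp add: d_def)
  have ode': "(\<nu> has_real_derivative - (c t / (n * d t))) (at t)" if "t \<in> J" for t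
    using ode[OF that] by (simp add: c_def d_def)
  have c': "(c has_real_derivative c t / n) (at t)" if "t \<in> J" for t
  proof -
    define D where "D = - (c t / (n * d t))"
    have "(\<nu> has_real_derivative D) (at t)" unfolding D_def by (rule ode'[OF that])
    then have "(c has_real_derivative (sinh (\<nu> t) - cosh (\<nu> t) * k) * D) (at t)"
      unfolding c_def[abs_def] by (auto intro!: derivative_eq_intros simp: algebra_simps)
    also have "(sinh (\<nu> t) - cosh (\<nu> t) * k) * D = c t / n"
    proof -
      have "sinh (\<nu> t) - cosh (\<nu> t) * k = - d t" by (simp add: d_def)
      then show ?thesis using d_nz[OF that] by (simp add: D_def)
    qed
    finally show ?thesis .
  qed
  have "((\<lambda>t. c t * exp (- t / n)) has_real_derivative 0) (at t within J)" if "t \<in> J" for t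
  proof -
    have "((\<lambda>t. c t * exp (- t / n)) has_real_derivative 0) (at t)"
      using assms(1) by (auto intro!: derivative_eq_intros c'[OF that])
    then show ?thesis by (rule has_field_derivative_at_within)
  qed
  then have "\<exists>C. \<forall>t\<in>J. c t * exp (- t / n) = C"
    by (rule has_field_derivative_zero_constant[OF convex])
  then obtain C where C: "\<forall>t\<in>J. c t * exp (- t / n) = C" ..
  have "C = 1" using bspec[OF C J(2)] assms(6) by (simp add: c_def)
  then have c: "c t = exp (t / n)"
    using bspec[OF C \<open>t \<in> J\<close>] \<open>C = 1\<close> by (simp add: exp_minus field_simps)
  have "continuous_on J d"
    unfolding d_def using ode' by (intro continuous_intros continuous_at_imp_continuous_on ballI DERIV_isCont)
  then have conn: "is_interval (d ` J)"
    using J(1) by (simp add: is_interval_connected_1 connected_continuous_image)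
  have "d t > 0"
  proof (rule ccontr)
    assume "\<not> d t > 0"
    moreover have "d 0 = k" using assms(6) by (simp add: d_def)
    ultimately have "0 \<in> d ` J"
      using conn J(2) \<open>t \<in> J\<close> assms(2) unfolding is_interval_1 by (metis image_eqI less_imp_le not_less)
    then show False using d_nz by auto
  qed
  have "(d t)\<^sup>2 - (c t)\<^sup>2 = (k\<^sup>2 - 1) * ((cosh (\<nu> t))\<^sup>2 - (sinh (\<nu> t))\<^sup>2)"
    by (simp add: c_def d_def power2_eq_square algebra_simps)
  also have "\<dots> = k\<^sup>2 - 1" by (simp add: cosh_square_eq)
  finally have d2: "(d t)\<^sup>2 = flow_discriminant n k t"
    by (simp add: flow_discriminant_exp c)
  then have dom: "t \<in> flow_domain n k"
    using \<open>d t > 0\<close> unfolding flow_domain_def by (metis mem_Collect_eq zero_less_power)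
  have d: "d t = sqrt (flow_discriminant n k t)" using d2 \<open>d t > 0\<close> by (simp add: real_sqrt_unique)
  have k2: "1 - k\<^sup>2 \<noteq> 0" using assms(2,3) power2_eq_1_iff[of k] by auto
  have "(1 - k\<^sup>2) * sinh (\<nu> t) = k * c t - d t"
    by (simp add: c_def d_def power2_eq_square algebra_simps)
  then have "sinh (\<nu> t) = sinh (flow_distance n k t)"
    unfolding cosh_sinh_flow_distance(2)[OF assms(2,3) dom] c d using k2 by (simp add: field_simps)
  then show ?thesis using dom by simp
qed

section \<open>The flow through parallel hypersurfaces\<close>

context umbilic_hypersurface
begin

definition flow :: "real \<Rightarrow> 'm \<Rightarrow> 'n lorentz" where
  "flow t = combination (cosh (flow_distance (real CARD('n)) k t)) (sinh (flow_distance (real CARD('n)) k t))"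

lemma combination_has_vector_derivative:
  assumes "(\<nu> has_real_derivative D) (at t)"
  shows "((\<lambda>s. combination (cosh (\<nu> s)) (sinh (\<nu> s)) x) has_vector_derivative
    D *\<^sub>R combination (sinh (\<nu> t)) (cosh (\<nu> t)) x) (at t)"
proof -
  have "((\<lambda>s. cosh (\<nu> s)) has_real_derivative sinh (\<nu> t) * D) (at t)"
    "((\<lambda>s. sinh (\<nu> s)) has_real_derivative cosh (\<nu> t) * D) (at t)"
    using assms by (auto intro!: derivative_eq_intros)
  from this[THEN has_vector_derivative_scaleR[OF _ has_vector_derivative_const]]
  have "((\<lambda>s. cosh (\<nu> s) *\<^sub>R F x + sinh (\<nu> s) *\<^sub>R N x) has_vector_derivative
      (sinh (\<nu> t) * D) *\<^sub>R F x + (cosh (\<nu> t) * D) *\<^sub>R N x) (at t)"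
    by (intro has_vector_derivative_add) simp_all
  then show ?thesis by (simp add: combination_def algebra_simps)
qed

lemma hypersurface_flow:
  assumes "k > 0" "k \<noteq> 1" "t \<in> flow_domain (real CARD('n)) k"
  shows "hypersurface A (flow t)"
  unfolding flow_def
  by (rule hypersurface_combination)
    (simp_all add: cosh_square_eq flow_distance_focal(1)[OF assms])

lemma parallel_imcf_solution_flow:
  assumes k: "k > 0" "k \<noteq> 1"
  shows "parallel_imcf_solution A F N (flow_domain (real CARD('n)) k)
    (flow_distance (real CARD('n)) k) flow"
proof -
  let ?n = "real CARD('n)"
  define \<mu> where "\<mu> = flow_distance ?n k"
  have n: "?n > 0" by simp
  have "flow 0 = F"
    by (simp add: flow_def flow_distance_zero[OF k(1)] combination_def fun_eq_iff)
  moreover have "inward_unit_normal A (flow t) (combination (sinh (\<mu> t)) (cosh (\<mu> t))) \<and>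
      (\<forall>x. ((\<lambda>s. flow s x) has_vector_derivative
        - (1 / mean_curvature A (flow t) (combination (sinh (\<mu> t)) (cosh (\<mu> t))) x)
          *\<^sub>R combination (sinh (\<mu> t)) (cosh (\<mu> t)) x) (at t))"
    if t: "t \<in> flow_domain ?n k" for t
  proof -
    have H: "mean_curvature A (flow t) (combination (sinh (\<mu> t)) (cosh (\<mu> t))) x
        = ?n * (sqrt (flow_discriminant ?n k t) / exp (t / ?n))" for x
      using hypersurface_flow[OF k t] unfolding flow_def
      by (simp add: mean_curvature_combination \<mu>_def flow_distance_focal[OF k t])
    have "unit_normal A (flow t) (combination (sinh (\<mu> t)) (cosh (\<mu> t)))"
      unfolding flow_def \<mu>_def by (rule unit_normal_combination) (simp add: cosh_square_eq)
    moreover have "flow_discriminant ?n k t > 0" using t by (simp add: flow_domain_def)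
    ultimately have 1: "inward_unit_normal A (flow t) (combination (sinh (\<mu> t)) (cosh (\<mu> t)))"
      by (simp add: inward_unit_normal_def H)
    have "(\<mu> has_real_derivative - (1 / (?n * (sqrt (flow_discriminant ?n k t) / exp (t / ?n))))) (at t)"
      using flow_distance_has_derivative[OF n k(1) t] by (simp add: \<mu>_def)
    from combination_has_vector_derivative[OF this] 1 show ?thesis
      unfolding H by (simp add: flow_def[abs_def] \<mu>_def)
  qed
  ultimately show ?thesis
    using open_interval_flow_domain[OF n k] flow_domain_zero[OF k(1)] hypersurface_flow[OF k]
      smooth_flow_distance[OF n k]
    unfolding parallel_imcf_solution_def imcf_solution_def
    by (auto simp: flow_def combination_def
        intro!: exI[of _ "\<lambda>t. combination (sinh (\<mu> t)) (cosh (\<mu> t))"])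
qed

text \<open>A solution provides some inward unit normal \<open>M\<close>, a priori unrelated to \<open>P = sinh \<nu> F + cosh \<nu> N\<close>.
  The flow equation reads \<open>\<nu>' P = - M / H\<close>; comparing lengths gives \<open>H = 1 / \<bar>\<nu>'\<bar>\<close> and \<open>M = e P\<close>
  with \<open>e = - sgn \<nu>'\<close>, one sign for the whole hypersurface.  The mean curvature formula for this
  \<open>M\<close> then turns the flow equation into an equation for \<open>\<nu>\<close> in which the sign cancels.\<close>

lemma parallel_imcf_solution_ode:
  assumes sol: "parallel_imcf_solution A F N J \<nu> \<Psi>" and t: "t \<in> J"
  shows "cosh (\<nu> t) * k - sinh (\<nu> t) \<noteq> 0"
    and "(\<nu> has_real_derivative - ((cosh (\<nu> t) - sinh (\<nu> t) * k)
      / (real CARD('n) * (cosh (\<nu> t) * k - sinh (\<nu> t))))) (at t)"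
proof -
  let ?n = "real CARD('n)"
  let ?P = "combination (sinh (\<nu> t)) (cosh (\<nu> t))"
  let ?c = "cosh (\<nu> t) - sinh (\<nu> t) * k" and ?d = "cosh (\<nu> t) * k - sinh (\<nu> t)"
  have J: "open J" and \<Psi>: "\<And>s. s \<in> J \<Longrightarrow> \<Psi> s = combination (cosh (\<nu> s)) (sinh (\<nu> s))"
    and hyp: "hypersurface A (\<Psi> t)"
    using sol t by (auto simp: parallel_imcf_solution_def imcf_solution_def combination_def fun_eq_iff)
  obtain M where M: "inward_unit_normal A (\<Psi> t) M"
    and flow_eq: "\<And>x. ((\<lambda>s. \<Psi> s x) has_vector_derivative
      - (1 / mean_curvature A (\<Psi> t) M x) *\<^sub>R M x) (at t)"
    using sol t unfolding parallel_imcf_solution_def imcf_solution_def by blast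
  have "smooth_on J \<nu>" using sol by (simp add: parallel_imcf_solution_def)
  from smooth_on_has_derivative[OF this t]
  obtain D where D: "(\<nu> has_real_derivative D) (at t)"
    using has_derivative_imp_has_field_derivative differentiable_def real_differentiable_def
    by metis
  have H: "mean_curvature A (\<Psi> t) M x > 0" for x using M by (simp add: inward_unit_normal_def)
  have vel: "D *\<^sub>R ?P x = - (1 / mean_curvature A (\<Psi> t) M x) *\<^sub>R M x" for x
  proof -
    have "((\<lambda>s. \<Psi> s x) has_vector_derivative D *\<^sub>R ?P x) (at t)"
      by (rule has_vector_derivative_transform_within_open[OF
            combination_has_vector_derivative[OF D] J t]) (simp add: \<Psi>)
    then show ?thesis using flow_eq vector_derivative_unique_at by blast
  qed
  have PP: "lorentz_inner (?P x) (?P x) = 1" for x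
    by (simp add: combination_products power2_eq_square[symmetric] cosh_square_eq)
  have MM: "lorentz_inner (M x) (M x) = 1" for x
    using M by (simp add: inward_unit_normal_def unit_normal_def)
  have M_eq: "M x = (- (mean_curvature A (\<Psi> t) M x * D)) *\<^sub>R ?P x" for x
  proof -
    have "mean_curvature A (\<Psi> t) M x *\<^sub>R (D *\<^sub>R ?P x) = - M x"
      unfolding vel using H[of x] by simp
    then show ?thesis by simp
  qed
  have HD: "(mean_curvature A (\<Psi> t) M x * D)\<^sup>2 = 1" for x
  proof -
    have "lorentz_inner ((- h) *\<^sub>R ?P x) ((- h) *\<^sub>R ?P x) = h\<^sup>2" for h
      unfolding lorentz_simps PP by (simp add: power2_eq_square)
    from this[of "mean_curvature A (\<Psi> t) M x * D"] show ?thesis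
      unfolding M_eq[symmetric] MM by simp
  qed
  then have "D \<noteq> 0" by (metis mult_zero_right power_zero_numeral zero_neq_one)
  have "mean_curvature A (\<Psi> t) M x * \<bar>D\<bar> = 1" for x
  proof -
    have "\<bar>mean_curvature A (\<Psi> t) M x * D\<bar> = 1" using HD[of x] by (simp add: power2_eq_1_iff) linarith
    then show ?thesis using H[of x] by (simp add: abs_mult)
  qed
  then have H_eq: "mean_curvature A (\<Psi> t) M x = 1 / \<bar>D\<bar>" for x
    using \<open>D \<noteq> 0\<close> by (simp add: field_simps)
  define e where "e = - (D / \<bar>D\<bar>)"
  have e: "e = 1 \<or> e = -1" using \<open>D \<noteq> 0\<close> by (auto simp: e_def abs_if)
  have "M = combination (e * sinh (\<nu> t)) (e * cosh (\<nu> t))"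
    by (rule ext) (subst M_eq, simp add: H_eq e_def combination_def algebra_simps)
  moreover have c: "?c \<noteq> 0"
    using hypersurface_combination_nondegenerate hyp unfolding \<Psi>[OF t] by blast
  ultimately have "1 / \<bar>D\<bar> = ?n * ((e * cosh (\<nu> t) * k - e * sinh (\<nu> t)) / ?c)"
    using H_eq mean_curvature_combination hyp unfolding \<Psi>[OF t] by metis
  then have "1 / \<bar>D\<bar> = e * (?n * ?d / ?c)" by (simp add: algebra_simps)
  moreover have "1 / \<bar>D\<bar> = e * (- (1 / D))" using \<open>D \<noteq> 0\<close> by (simp add: e_def)
  ultimately have key: "- (1 / D) = ?n * ?d / ?c" using e by auto
  then show d: "?d \<noteq> 0" using \<open>D \<noteq> 0\<close> by auto
  have "D = - (?c / (?n * ?d))"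
    using key \<open>D \<noteq> 0\<close> c d by (simp add: field_simps)
  then show "(\<nu> has_real_derivative - (?c / (?n * ?d))) (at t)" using D by simp
qed

lemma parallel_imcf_solution_unique:
  assumes k: "k > 0" "k \<noteq> 1"
    and sol: "parallel_imcf_solution A F N J \<nu> \<Psi>" and t: "t \<in> J"
  shows "t \<in> flow_domain (real CARD('n)) k \<and> \<nu> t = flow_distance (real CARD('n)) k t \<and> \<Psi> t = flow t"
proof -
  have J: "is_interval J" "0 \<in> J" "\<Psi> 0 = F"
    and \<Psi>: "\<And>s. s \<in> J \<Longrightarrow> \<Psi> s = combination (cosh (\<nu> s)) (sinh (\<nu> s))"
    using sol by (auto simp: parallel_imcf_solution_def imcf_solution_def combination_def fun_eq_iff)
  have "combination (cosh (\<nu> 0)) (sinh (\<nu> 0)) x = F x" for x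
    using \<Psi>[OF J(2)] J(3) by simp
  then have "lorentz_inner (combination (cosh (\<nu> 0)) (sinh (\<nu> 0)) x) (N x) = 0" for x by simp
  then have "\<nu> 0 = 0" by (simp add: combination_def lorentz_simps)
  have "t \<in> flow_domain (real CARD('n)) k \<and> \<nu> t = flow_distance (real CARD('n)) k t"
    by (rule flow_distance_unique[of "real CARD('n)" k J \<nu> t])
      (use k J(1,2) t \<open>\<nu> 0 = 0\<close> parallel_imcf_solution_ode[OF sol] in \<open>simp_all\<close>)
  then show ?thesis using \<Psi>[OF t] by (simp add: flow_def)
qed

lemma maximal_parallel_imcf_solution_flow:
  assumes "k > 0" "k \<noteq> 1"
  shows "maximal_parallel_imcf_solution A F N (flow_domain (real CARD('n)) k)
    (flow_distance (real CARD('n)) k) flow"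
  unfolding maximal_parallel_imcf_solution_def
  using parallel_imcf_solution_flow[OF assms] parallel_imcf_solution_unique[OF assms] by blast

text \<open>The left end of the interval of definition, finite or not, is covered by prescribing the limit \<open>E\<close> of
  \<open>exp (t / n)\<close>: it is \<open>sqrt (1 - k\<^sup>2)\<close> at the finite end and \<open>0\<close> at minus infinity.\<close>

lemma flow_tendsto:
  assumes k: "k > 0" "k \<noteq> 1" and dom: "eventually (\<lambda>t. t \<in> flow_domain (real CARD('n)) k) T"
    and E: "((\<lambda>t. exp (t / real CARD('n))) \<longlongrightarrow> E) T"
  shows "((\<lambda>t. flow t x) \<longlongrightarrow> combination ((E - k * sqrt (E\<^sup>2 + k\<^sup>2 - 1)) / (1 - k\<^sup>2))
    ((k * E - sqrt (E\<^sup>2 + k\<^sup>2 - 1)) / (1 - k\<^sup>2)) x) T"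
proof -
  have k2: "1 - k\<^sup>2 \<noteq> 0" using k power2_eq_1_iff[of k] by auto
  have "((\<lambda>t. combination ((exp (t / real CARD('n)) - k * sqrt ((exp (t / real CARD('n)))\<^sup>2 + k\<^sup>2 - 1)) / (1 - k\<^sup>2))
    ((k * exp (t / real CARD('n)) - sqrt ((exp (t / real CARD('n)))\<^sup>2 + k\<^sup>2 - 1)) / (1 - k\<^sup>2)) x)
    \<longlongrightarrow> combination ((E - k * sqrt (E\<^sup>2 + k\<^sup>2 - 1)) / (1 - k\<^sup>2))
    ((k * E - sqrt (E\<^sup>2 + k\<^sup>2 - 1)) / (1 - k\<^sup>2)) x) T"
    unfolding combination_def by (intro tendsto_intros E k2)
  then show ?thesis
    by (rule Lim_transform_eventually)
      (rule eventually_mono[OF dom],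
        simp add: flow_def cosh_sinh_flow_distance[OF k] flow_discriminant_exp)
qed

text \<open>The distance tends to minus infinity, so the hyperbolic cosine grows like \<open>exp (t / n)\<close>; the time
  coordinate of the flow is at least this cosine times the positive constant
  \<open>fst (F x) - \<bar>fst (N x)\<bar>\<close>.\<close>

lemma flow_converges_to_ideal_boundary:
  assumes k: "k > 0" "k \<noteq> 1"
  shows "converges_to_ideal_boundary flow at_top"
  unfolding converges_to_ideal_boundary_def
proof
  fix x
  let ?n = "real CARD('n)"
  define \<mu> where "\<mu> = flow_distance ?n k"
  define \<delta> where "\<delta> = fst (F x) - \<bar>fst (N x)\<bar>"
  have \<delta>: "\<delta> > 0" using time_coordinates[of x] by (simp add: \<delta>_def)
  have dom: "eventually (\<lambda>t. t \<in> flow_domain ?n k) at_top"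
  proof (cases "k < 1")
    case True
    have "?n > 0" by simp
    show ?thesis unfolding flow_domain_greaterThan[OF \<open>?n > 0\<close> k(1) True] greaterThan_iff
      by (rule eventually_gt_at_top)
  next
    case False
    then show ?thesis using k by (simp add: flow_domain_UNIV)
  qed
  have "filterlim (\<lambda>t. (1 / ?n) * t) at_top at_top"
    by (rule filterlim_tendsto_pos_mult_at_top[OF tendsto_const _ filterlim_ident]) simp
  from filterlim_compose[OF exp_at_top this]
  have exp_top: "filterlim (\<lambda>t. exp (t / ?n)) at_top at_top" by simp
  have ge: "fst (flow t x) \<ge> \<delta> / (2 * (1 + k)) * exp (t / ?n)" if t: "t \<in> flow_domain ?n k" for t
  proof -
    have s: "sqrt (flow_discriminant ?n k t) > 0" using t by (simp add: flow_domain_def)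
    have "exp (- \<mu> t) = (exp (t / ?n) + sqrt (flow_discriminant ?n k t)) / (1 + k)"
      using k(1) s by (simp add: \<mu>_def flow_distance_def exp_minus add_pos_pos)
    also have "\<dots> \<ge> exp (t / ?n) / (1 + k)"
      using k(1) s by (intro divide_right_mono) auto
    finally have "exp (t / ?n) / (1 + k) / 2 \<le> exp (- \<mu> t) / 2"
      by (rule divide_right_mono) simp
    also have "\<dots> \<le> cosh (\<mu> t)" by (simp add: cosh_field_def)
    finally have "cosh (\<mu> t) \<ge> exp (t / ?n) / (1 + k) / 2" .
    then have "cosh (\<mu> t) * \<delta> \<ge> exp (t / ?n) / (1 + k) / 2 * \<delta>"
      by (rule mult_right_mono) (use \<delta> in simp)
    also have "fst (flow t x) \<ge> cosh (\<mu> t) * \<delta>"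
      unfolding flow_def \<mu>_def \<delta>_def
    proof (rule time_combination_ge)
      let ?m = "flow_distance ?n k t"
      have "(sinh ?m)\<^sup>2 \<le> (cosh ?m)\<^sup>2" by (simp add: cosh_square_eq)
      then show "\<bar>sinh ?m\<bar> \<le> cosh ?m" by (simp add: abs_le_square_iff[symmetric])
    qed
    finally show ?thesis by (simp add: field_simps)
  qed
  have "filterlim (\<lambda>t. \<delta> / (2 * (1 + k)) * exp (t / ?n)) at_top at_top"
    using \<delta> k(1) by (intro filterlim_tendsto_pos_mult_at_top[OF tendsto_const _ exp_top]) auto
  then have top: "filterlim (\<lambda>t. fst (flow t x)) at_top at_top"
    by (rule filterlim_at_top_mono) (rule eventually_mono[OF dom ge])
  have "((\<lambda>t. 2 / (fst (flow t x) + 1)) \<longlongrightarrow> 0) at_top"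
    by (intro tendsto_divide_0[OF tendsto_const] filterlim_at_top_imp_at_infinity)
      (rule filterlim_at_top_mono[OF top], simp)
  then have "((\<lambda>t. sqrt (1 - 2 / (fst (flow t x) + 1))) \<longlongrightarrow> sqrt (1 - 0)) at_top"
    by (intro tendsto_intros)
  then have "((\<lambda>t. sqrt (1 - 2 / (fst (flow t x) + 1))) \<longlongrightarrow> 1) at_top" by simp
  moreover have "sqrt (1 - 2 / (fst (flow t x) + 1)) = norm (poincare_ball_map (flow t x))"
    if t: "t \<in> flow_domain ?n k" for t
  proof -
    have h: "flow t x \<in> hyperbolic_space"
      using hypersurface_flow[OF k t] by (simp add: hypersurface_def)
    then have "fst (flow t x) > 0" by (simp add: hyperbolic_space_def)
    then show ?thesis by (simp add: norm_poincare_ball_map[OF h] field_simps)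
  qed
  ultimately show "((\<lambda>t. norm (poincare_ball_map (flow t x))) \<longlongrightarrow> 1) at_top"
    by (rule Lim_transform_eventually[OF _ eventually_mono[OF dom]])
qed

text \<open>At the end point the coefficients are \<open>1 / r\<close> and \<open>k / r\<close> with \<open>r = sqrt (1 - k\<^sup>2)\<close>.  The limit is
  still an immersion, since \<open>1 / r - k (k / r) = r\<close>, while its normal has coefficients
  \<open>k / r\<close> and \<open>1 / r\<close> and hence zero differential.\<close>

lemma flow_converges_to_totally_geodesic:
  assumes k: "0 < k" "k < 1"
  shows "converges_to_totally_geodesic A flow (at_right (real CARD('n) / 2 * ln (1 - k\<^sup>2)))"
proof -
  let ?n = "real CARD('n)"
  let ?t = "?n / 2 * ln (1 - k\<^sup>2)"
  have pos: "1 - k\<^sup>2 > 0" using k by (simp add: power_less_one_iff)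
  define r where "r = sqrt (1 - k\<^sup>2)"
  have r: "r > 0" "r\<^sup>2 = 1 - k\<^sup>2" using pos by (simp_all add: r_def)
  have "exp (?t / ?n) = r"
    using pos by (simp add: r_def ln_sqrt[symmetric] exp_ln_iff real_sqrt_gt_zero)
  have "isCont (\<lambda>t. exp (t / ?n)) ?t" by (intro continuous_intros) simp
  then have "((\<lambda>t. exp (t / ?n)) \<longlongrightarrow> exp (?t / ?n)) (at_right ?t)"
    unfolding isCont_def by (rule tendsto_within_subset) simp
  then have E: "((\<lambda>t. exp (t / ?n)) \<longlongrightarrow> r) (at_right ?t)" using \<open>exp (?t / ?n) = r\<close> by simp
  have dom: "eventually (\<lambda>t. t \<in> flow_domain ?n k) (at_right ?t)"
  proof -
    have "?n > 0" by simp
    show ?thesis unfolding flow_domain_greaterThan[OF \<open>?n > 0\<close> k] greaterThan_iff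
      by (rule eventually_at_right_less)
  qed
  have lim: "((\<lambda>t. flow t x) \<longlongrightarrow> combination (1 / r) (k / r) x) (at_right ?t)" for x
  proof -
    have "r\<^sup>2 + k\<^sup>2 - 1 = 0" using r(2) by simp
    moreover have "r / (1 - k\<^sup>2) = 1 / r" "k * r / (1 - k\<^sup>2) = k / r"
      unfolding r(2)[symmetric] using r(1) by (simp_all add: power2_eq_square)
    ultimately show ?thesis using flow_tendsto[OF k(1) _ dom E, of x] k by simp
  qed
  have unit: "(1 / r)\<^sup>2 - (k / r)\<^sup>2 = 1"
    using r pos by (simp add: power_divide diff_divide_distrib[symmetric])
  have "1 / r - k / r * k = (1 - k\<^sup>2) / r"
    by (simp add: power2_eq_square diff_divide_distrib)
  then have "hypersurface A (combination (1 / r) (k / r))"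
    using r pos by (intro hypersurface_combination[OF unit]) auto
  moreover have "second_fundamental_form A (combination (1 / r) (k / r)) (combination (k / r) (1 / r)) x v w = 0"
    for x v w by (simp add: second_fundamental_form_combination)
  ultimately have "totally_geodesic A (combination (1 / r) (k / r))"
    unfolding totally_geodesic_def using unit_normal_combination[OF unit] by blast
  then show ?thesis unfolding converges_to_totally_geodesic_def using lim by blast
qed

text \<open>The limit has coefficients \<open>k / r\<close> and \<open>1 / r\<close> with \<open>r = sqrt (k\<^sup>2 - 1)\<close>, that is, it is the
  common centre of the parallel geodesic spheres: its differential vanishes identically.\<close>

lemma flow_converges_to_point:
  assumes "connected (UNIV :: 'm set)" "k > 1"
  shows "converges_to_point flow at_bot"
proof -
  let ?n = "real CARD('n)"
  define r where "r = sqrt (k\<^sup>2 - 1)"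
  have "k\<^sup>2 > 1" using assms(2) by (simp add: one_less_power)
  then have r: "r > 0" "r\<^sup>2 = k\<^sup>2 - 1" by (simp_all add: r_def)
  have "filterlim (\<lambda>t. (1 / ?n) * t) at_bot at_bot"
    by (rule filterlim_tendsto_pos_mult_at_bot[OF tendsto_const _ filterlim_ident]) simp
  from filterlim_compose[OF exp_at_bot this]
  have E: "((\<lambda>t. exp (t / ?n)) \<longlongrightarrow> 0) at_bot" by simp
  have dom: "eventually (\<lambda>t. t \<in> flow_domain ?n k) at_bot"
    using assms(2) by (simp add: flow_domain_UNIV)
  have a: "(0 - k * sqrt (0\<^sup>2 + k\<^sup>2 - 1)) / (1 - k\<^sup>2) = k / r"
    "(k * 0 - sqrt (0\<^sup>2 + k\<^sup>2 - 1)) / (1 - k\<^sup>2) = 1 / r"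
  proof -
    have "1 - k\<^sup>2 = - (r * r)" using r(2) by (simp add: power2_eq_square)
    then show "(0 - k * sqrt (0\<^sup>2 + k\<^sup>2 - 1)) / (1 - k\<^sup>2) = k / r"
      "(k * 0 - sqrt (0\<^sup>2 + k\<^sup>2 - 1)) / (1 - k\<^sup>2) = 1 / r"
      using r(1) by (simp_all add: r_def[symmetric])
  qed
  have lim: "((\<lambda>t. flow t x) \<longlongrightarrow> combination (k / r) (1 / r) x) at_bot" for x
    using flow_tendsto[OF _ _ dom E, of x] assms(2) unfolding a by simp
  have "differential A (combination (k / r) (1 / r)) x = (\<lambda>v. 0)" for x
    by (simp add: fun_eq_iff differential_combination)
  from zero_differential_imp_constant[OF atlas assms(1) smooth_combination this]
  have const: "combination (k / r) (1 / r) x = combination (k / r) (1 / r) y" for x y .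
  have "(k / r)\<^sup>2 - (1 / r)\<^sup>2 = 1"
    using r \<open>k\<^sup>2 > 1\<close> by (simp add: power_divide diff_divide_distrib[symmetric])
  then have "combination (k / r) (1 / r) y \<in> hyperbolic_space" for y
    using r assms(2) by (intro combination_in_hyperbolic_space) auto
  then show ?thesis unfolding converges_to_point_def using lim const by metis
qed

end

section \<open>The solution through an umbilic hypersurface\<close>

theorem theorem3p4:
  fixes A :: "('m::{t2_space,second_countable_topology}, 'n::finite) chart set"
    and F N :: "'m \<Rightarrow> 'n lorentz"
    and k n tstar :: real
    and q :: "real \<Rightarrow> real"
  assumes "smooth_atlas A"
    and "connected (UNIV :: 'm set)"
    and "hypersurface A F"
    and "inward_unit_normal A F N"
    and "totally_umbilic A F N"
    and "\<forall>x. principal_curvatures A F N x = {k}"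
    and "k \<notin> {-1, 0, 1}"
    and "n = real CARD('n)"
    and "q = (\<lambda>t. exp (2 * t / n) + k\<^sup>2 - 1)"
    and "tstar = n / 2 * ln (1 - k\<^sup>2)"
  shows "\<exists>I \<mu> \<Phi>. maximal_parallel_imcf_solution A F N I \<mu> \<Phi> \<and>
    (\<forall>t\<in>I.
      cosh (\<mu> t) = (exp (t / n) - \<bar>k\<bar> * sqrt (q t)) / (1 - k\<^sup>2) \<and>
      sinh (\<mu> t) = sgn k * ((\<bar>k\<bar> * exp (t / n) - sqrt (q t)) / (1 - k\<^sup>2))) \<and>
    (0 < \<bar>k\<bar> \<and> \<bar>k\<bar> < 1 \<longrightarrow>
      I = {tstar<..} \<and> immortal I \<and>
      converges_to_totally_geodesic A \<Phi> (at_right tstar) \<and>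
      converges_to_ideal_boundary \<Phi> at_top) \<and>
    (\<bar>k\<bar> > 1 \<longrightarrow>
      I = UNIV \<and> eternal I \<and>
      converges_to_point \<Phi> at_bot \<and>
      converges_to_ideal_boundary \<Phi> at_top)"
proof -
  have normal: "unit_normal A F N" and Hpos: "\<And>x. mean_curvature A F N x > 0"
    using assms(4) by (auto simp: inward_unit_normal_def)
  have II: "second_fundamental_form A F N x v w = k * induced_metric A F x v w" for x v w
  proof -
    obtain c where c: "\<And>v w. second_fundamental_form A F N x v w = c * induced_metric A F x v w"
      using assms(5) unfolding totally_umbilic_def by blast
    have "{c} = {k}" using mean_curvature_umbilic(1)[OF assms(1,3) c] assms(6) by simp
    then show ?thesis using c by simp
  qed
  interpret umbilic_hypersurface A F N k
    using assms(1,3) normal umbilic_shape_operator[OF assms(1,3) normal II]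
    by unfold_locales
  have n: "n > 0" using assms(8) by simp
  have "n * k > 0" using Hpos mean_curvature_umbilic(2)[OF assms(1,3) II] assms(8) by simp
  then have "k > 0" using n by (simp add: zero_less_mult_iff)
  have "k \<noteq> 1" using assms(7) by simp
  note k = \<open>k > 0\<close> \<open>k \<noteq> 1\<close>
  have q: "q = flow_discriminant n k" by (simp add: assms(9) flow_discriminant_def fun_eq_iff)
  have imm: "immortal {tstar<..}" if "k < 1"
  proof -
    have "tstar < 0"
      using k that n by (simp add: assms(10) mult_pos_neg power_less_one_iff)
    then show ?thesis by (auto simp: immortal_def)
  qed
  show ?thesis
  proof (intro exI[of _ "flow_domain n k"] exI[of _ "flow_distance n k"] exI[of _ flow] conjI impI ballI)
    show "maximal_parallel_imcf_solution A F N (flow_domain n k) (flow_distance n k) flow"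
      unfolding assms(8) by (rule maximal_parallel_imcf_solution_flow[OF k])
    fix t assume t: "t \<in> flow_domain n k"
    show "cosh (flow_distance n k t) = (exp (t / n) - \<bar>k\<bar> * sqrt (q t)) / (1 - k\<^sup>2)"
      "sinh (flow_distance n k t) = sgn k * ((\<bar>k\<bar> * exp (t / n) - sqrt (q t)) / (1 - k\<^sup>2))"
      using k by (simp_all add: q cosh_sinh_flow_distance[OF k t])
  next
    show "converges_to_ideal_boundary flow at_top" "converges_to_ideal_boundary flow at_top"
      by (rule flow_converges_to_ideal_boundary[OF k])+
  next
    assume "0 < \<bar>k\<bar> \<and> \<bar>k\<bar> < 1"
    then have k1: "k < 1" by linarith
    show dom: "flow_domain n k = {tstar<..}"
      using flow_domain_greaterThan[OF n k(1) k1] by (simp add: assms(10))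
    show "immortal (flow_domain n k)" unfolding dom by (rule imm[OF k1])
    show "converges_to_totally_geodesic A flow (at_right tstar)"
      unfolding assms(10,8) by (rule flow_converges_to_totally_geodesic[OF k(1) k1])
  next
    assume "\<bar>k\<bar> > 1"
    then have k1: "k > 1" using k(1) by simp
    show dom: "flow_domain n k = UNIV" by (rule flow_domain_UNIV[OF k1])
    then show "eternal (flow_domain n k)" by (simp add: eternal_def)
    show "converges_to_point flow at_bot" by (rule flow_converges_to_point[OF assms(2) k1])
  qed
qed

end
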